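(* Let $p\in\mathcal{P}_1^{\log}(\mathbb{R}^n)$, $\alpha\in\mathcal{P}_0^{\log}(\mathbb{R}^n)$ and $1<p^-\le p^+<\frac{n}{\alpha^+}$. If $f\in w\text{-}L^{p(\cdot)}(\mathbb{R}^n)$ and $|f|^{p(\cdot)/p^\#_\alpha(\cdot)}\in w\text{-}L^{p^\#_\alpha(\cdot)}(\mathbb{R}^n)$, then the function $x\mapsto\mathcal{I}_{\alpha(x)}f(x)$ belongs to $w\text{-}L^{p^\#_\alpha(\cdot)}(\mathbb{R}^n)$.
   Context: For measurable $g$ write $g^-:=\operatorname{ess\,inf}g$, $g^+:=\operatorname{ess\,sup}g$. $\mathcal{P}_0^{\log}(\mathbb{R}^n)$ is the set of $\log$-Hölder continuous $g:\mathbb{R}^n\to(0,\infty)$ with $0<g^-\le g^+<\infty$; $\mathcal{P}_1^{\log}(\mathbb{R}^n)$ is the subset with $g^-\ge1$. Here $g$ is $\log$-Hölder continuous if there are $c,c'>0$, $g_\infty\ge1$ with $|g(x)-g(y)|\le\frac{c}{\log(e+1/|x-y|)}$ for all $x,y$ and $|g(x)-g_\infty|\le\frac{c'}{\log(e+|x|)}$ for all $x$. Luxemburg norm: $\|f\|_{L^{s(\cdot)}}:=\inf\{\lambda>0:\int|f/\lambda|^{s(x)}dx\le1\}$. Weak space $w\text{-}L^{s(\cdot)}(\mathbb{R}^n)$: measurable $f$ with $\sup_{\lambda>0}\lambda\|\chi_{\{|f|>\lambda\}}\|_{L^{s(\cdot)}}<\infty$. Riesz potential: $\mathcal{I}_{\alpha(x)}f(x):=\int_{\mathbb{R}^n}\frac{|f(y)|}{|x-y|^{n-\alpha(x)}}\,dy$.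 Sobolev conjugate: $p^\#_\alpha(x):=\frac{np(x)}{n-\alpha(x)p(x)}$. *)

theory Defs
  imports "HOL-Probability.Essential_Supremum"
begin

text \<open>Essential bounds are taken in \<^typ>\<open>ereal\<close>, so that an essentially unbounded function has
  an infinite bound instead of an arbitrary real one.\<close>

definition ess_upper :: "(real ^ 'n \<Rightarrow> real) \<Rightarrow> ereal" where
  "ess_upper g = esssup lebesgue (\<lambda>x. ereal (g x))"

definition ess_lower :: "(real ^ 'n \<Rightarrow> real) \<Rightarrow> ereal" where
  "ess_lower g = - esssup lebesgue (\<lambda>x. - ereal (g x))"

text \<open>For \<open>x = y\<close> the first bound reads \<open>0 \<le> c\<close>, because \<open>1 / 0 = 0\<close>; so nothing is lost by
  quantifying over all pairs.\<close>

definition log_Holder :: "(real ^ 'n \<Rightarrow> real) \<Rightarrow> bool" where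
  "log_Holder g \<longleftrightarrow>
    (\<exists>c > 0. \<exists>c' > 0. \<exists>g_inf \<ge> 1.
      (\<forall>x y. \<bar>g x - g y\<bar> \<le> c / ln (exp 1 + 1 / norm (x - y))) \<and>
      (\<forall>x. \<bar>g x - g_inf\<bar> \<le> c' / ln (exp 1 + norm x)))"

definition P0_log :: "(real ^ 'n \<Rightarrow> real) set" where
  "P0_log = {g. (\<forall>x. 0 < g x) \<and> log_Holder g \<and>
     0 < ess_lower g \<and> ess_lower g \<le> ess_upper g \<and> ess_upper g < \<infinity>}"

definition P1_log :: "(real ^ 'n \<Rightarrow> real) set" where
  "P1_log = {g \<in> P0_log. 1 \<le> ess_lower g}"

text \<open>The norm is \<open>\<infinity>\<close> when no \<open>r\<close> is admissible.\<close>

definition luxemburg_norm :: "(real ^ 'n \<Rightarrow> real) \<Rightarrow> (real ^ 'n \<Rightarrow> real) \<Rightarrow> ennreal" where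
  "luxemburg_norm s f =
    Inf {ennreal r | r. 0 < r \<and> (\<integral>\<^sup>+x. ennreal (\<bar>f x / r\<bar> powr s x) \<partial>lebesgue) \<le> 1}"

text \<open>Members are extended-real valued, since a Riesz potential may a priori be infinite at some
  points; real-valued functions enter through the embedding \<^const>\<open>ereal\<close>.\<close>

definition weak_Lebesgue :: "(real ^ 'n \<Rightarrow> real) \<Rightarrow> (real ^ 'n \<Rightarrow> ereal) set" where
  "weak_Lebesgue s = {f \<in> borel_measurable lebesgue.
    (SUP t \<in> {0<..}. ennreal t * luxemburg_norm s (indicator {x. ereal t < \<bar>f x\<bar>})) < \<infinity>}"

definition riesz_potential ::
  "(real ^ 'n \<Rightarrow> real) \<Rightarrow> (real ^ 'n \<Rightarrow> real) \<Rightarrow> real ^ 'n \<Rightarrow> ennreal" where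
  "riesz_potential \<alpha> f x =
    (\<integral>\<^sup>+y. ennreal (\<bar>f y\<bar> / norm (x - y) powr (real CARD('n) - \<alpha> x)) \<partial>lebesgue)"

definition sobolev_conj ::
  "(real ^ 'n \<Rightarrow> real) \<Rightarrow> (real ^ 'n \<Rightarrow> real) \<Rightarrow> real ^ 'n \<Rightarrow> real" where
  "sobolev_conj \<alpha> p x = real CARD('n) * p x / (real CARD('n) - \<alpha> x * p x)"

end

theory Submission
  imports Defs
begin

text \<open>
  Write \<open>n\<close> for the dimension, \<open>q = p\<^sup>#\<^sub>\<alpha>\<close>, so that \<open>1/q = 1/p - \<alpha>/n\<close>, and \<open>e = q/p = 1 + q \<alpha>/n\<close>. After the
  weak norms have been turned into modular inequalities, a nonnegative \<open>f\<close> is given with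
  \<open>\<integral>_{f > t} t^p \<le> C\<close> and \<open>\<integral>_{f > t^e} t^q \<le> C\<close> for all \<open>t > 0\<close>, and the claim is that
  \<open>\<integral>_{I f > K t} t^q \<le> K\<close> for all \<open>t > 0\<close>. The level \<open>t\<close> is fixed, and the kernel is
  cut at a radius \<open>d(x)\<close> and \<open>f\<close> at a height \<open>l(y)\<close>, both depending on \<open>t\<close>. Three parts arise.

  The part \<open>|x - y| > d(x)\<close> is bounded by a multiple of \<open>t\<close> at every point. The first modular
  inequality bounds the integral of \<open>f\<close> over a ball of radius \<open>r\<close> by \<open>r^{n - n/p(x)}\<close> for \<open>r \<le> 1\<close> and by
  \<open>r^{n - n/p_\<infinity>}\<close> for \<open>r \<ge> 1\<close> (\<open>integral_cball_le_growth\<close>); the dyadic sum over annuli converges because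
  \<open>\<alpha>\<^sup>+ p\<^sup>+ < n\<close> (\<open>integral_far_le_growth\<close>). The part where \<open>|x - y| \<le> d(x)\<close> and \<open>f \<le> l\<close> is also bounded by a
  multiple of \<open>t\<close> at every point, since the kernel is integrable near its pole. The part where
  \<open>|x - y| \<le> d(x)\<close> and \<open>f > l\<close> is estimated in mean only, by Chebyshev's inequality with exponent one
  and Tonelli's theorem. The lemma \<open>weak_type_by_truncation\<close> combines the three.

  For \<open>t \<ge> 1\<close> the choice is \<open>d(x) = t^{-q(x)/n}\<close> and \<open>l = t^e\<close>. Then \<open>d(x) \<le> t^{-1/n}\<close>, and at this distance
  log-Hoelder continuity lets \<open>t^{g(x)}\<close> and \<open>t^{g(y)}\<close> differ only by a bounded factor, for every
  exponent \<open>g\<close> that occurs. The second modular inequality gives \<open>\<integral>_{f > t^e} f t^{q-e} \<le> C\<close>, which is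
  exactly what Tonelli's theorem asks for (\<open>integral_weighted_excess\<close>).

  For \<open>t < 1\<close> the ball \<open>|x| \<le> t^{-1/n}\<close> is negligible, for its measure is of order \<open>1/t\<close> and the weight
  satisfies \<open>t^q \<le> t\<close>. Off this ball the decay condition lets every exponent be replaced by its
  value at infinity, at the cost of a bounded factor. So the constant radius \<open>t^{-q_\<infinity>/n}\<close> and the
  constant height \<open>t^{e_\<infinity>}\<close> work as in the case of constant exponents, where the integral of
  \<open>f\<close> above this height is bounded by the first modular inequality.
\<close>

section \<open>Dyadic estimates\<close>

lemma ex_dyadic_scale:
  fixes u :: real
  assumes "1 < u"
  shows "\<exists>k::nat. 2 ^ k < u \<and> u \<le> 2 ^ Suc k"
proof -
  obtain m :: nat where m: "u < 2 ^ m"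
    using real_arch_pow[of 2 u] by auto
  define l where "l = (LEAST j::nat. u \<le> 2 ^ j)"
  have l: "u \<le> 2 ^ l"
    unfolding l_def by (rule LeastI[of _ m]) (use m in simp)
  have "l \<noteq> 0" using l assms by (intro notI) simp
  then obtain k where k: "l = Suc k" by (cases l) auto
  have "\<not> u \<le> 2 ^ k"
    using not_less_Least[of k "\<lambda>j. u \<le> 2 ^ j"] k by (simp add: l_def)
  with l k show ?thesis by (intro exI[of _ k]) auto
qed

lemma powr_mult_two_power:
  fixes r a :: real
  assumes "0 < r"
  shows "(r * 2 ^ k) powr a = r powr a * (2 powr a) ^ k"
  using assms by (simp add: powr_mult powr_power powr_powr mult.commute flip: powr_realpow)

lemma powr_div_two_power:
  fixes r a :: real
  assumes "0 < r"
  shows "(r / 2 ^ k) powr a = r powr a * (2 powr (-a)) ^ k"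
  using powr_mult_two_power[of "r / 2 ^ k" k a] assms
  by (simp add: powr_minus power_inverse field_simps)

text \<open>All improper integrals of the proof are controlled in this way: \<open>u\<close> compares a distance or a
  height with a reference value, and on each dyadic shell of \<open>u\<close> the power of \<open>u\<close> in the
  integrand is replaced by a constant, which loses a bounded factor only.\<close>
lemma dyadic_nn_integral_bound:
  fixes F :: "'a \<Rightarrow> ennreal" and G :: "nat \<Rightarrow> 'a \<Rightarrow> ennreal" and u :: "'a \<Rightarrow> real"
  assumes meas: "\<And>k. G k \<in> borel_measurable M"
    and big: "\<And>x. F x \<noteq> 0 \<Longrightarrow> 1 < u x"
    and maj: "\<And>x k. F x \<noteq> 0 \<Longrightarrow> 2 ^ k < u x \<Longrightarrow> u x \<le> 2 ^ Suc k \<Longrightarrow> F x \<le> G k x"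
    and int: "\<And>k. (\<integral>\<^sup>+x. G k x \<partial>M) \<le> ennreal (c * \<theta> ^ k)"
    and c: "0 \<le> c" and \<theta>: "0 \<le> \<theta>" "\<theta> < 1"
  shows "(\<integral>\<^sup>+x. F x \<partial>M) \<le> ennreal (c / (1 - \<theta>))"
proof -
  have "(\<integral>\<^sup>+x. F x \<partial>M) \<le> (\<integral>\<^sup>+x. (\<Sum>k. G k x) \<partial>M)"
  proof (rule nn_integral_mono)
    fix x
    show "F x \<le> (\<Sum>k. G k x)"
    proof (cases "F x = 0")
      case False
      from ex_dyadic_scale[OF big[OF False]] obtain k :: nat
        where "2 ^ k < u x" "u x \<le> 2 ^ Suc k" by blast
      with maj[OF False] have "F x \<le> G k x" by blast
      also have "\<dots> = (\<Sum>i\<in>{k}. G i x)" by simp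
      also have "\<dots> \<le> (\<Sum>i. G i x)" by (rule sum_le_suminf) auto
      finally show ?thesis .
    qed simp
  qed
  also have "\<dots> = (\<Sum>k. \<integral>\<^sup>+x. G k x \<partial>M)" by (rule nn_integral_suminf[OF meas])
  also have "\<dots> \<le> (\<Sum>k. ennreal (c * \<theta> ^ k))" by (intro suminf_le int) auto
  also have "\<dots> = ennreal (\<Sum>k. c * \<theta> ^ k)"
    using c \<theta> by (intro suminf_ennreal2 summable_mult summable_geometric) auto
  also have "(\<Sum>k. c * \<theta> ^ k) = c / (1 - \<theta>)"
    using \<theta> by (subst suminf_mult) (auto simp: suminf_geometric summable_geometric)
  finally show ?thesis .
qed

text \<open>Chebyshev's inequality, in the form in which modular inequalities enter below.\<close>
lemma emeasure_le_of_weight: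
  fixes w :: "'a \<Rightarrow> real"
  assumes "(\<integral>\<^sup>+y\<in>S. ennreal (w y) \<partial>M) \<le> ennreal c"
    and "B \<in> sets M" "B \<subseteq> S" "0 < m" "\<And>y. y \<in> B \<Longrightarrow> m \<le> w y" "0 \<le> c"
  shows "emeasure M B \<le> ennreal (c / m)"
proof -
  have "ennreal m * emeasure M B = (\<integral>\<^sup>+y. ennreal m * indicator B y \<partial>M)"
    using assms(2) by (simp add: nn_integral_cmult_indicator)
  also have "\<dots> \<le> (\<integral>\<^sup>+y\<in>S. ennreal (w y) \<partial>M)"
    using assms(3,5) by (intro nn_integral_mono) (auto simp: indicator_def intro!: ennreal_leI)
  also note assms(1)
  finally have "ennreal m * emeasure M B \<le> ennreal c" .
  then have "ennreal (1/m) * (ennreal m * emeasure M B) \<le> ennreal (1/m) * ennreal c"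
    by (intro mult_left_mono) auto
  then show ?thesis
    using assms(4,6) by (simp add: mult.assoc[symmetric] ennreal_mult[symmetric])
qed

lemma emeasure_cball_powr:
  fixes x :: "real ^ 'n"
  assumes "0 < r"
  shows "emeasure lborel (cball x r) =
    ennreal (unit_ball_vol (real CARD('n)) * r powr real CARD('n))"
  using assms emeasure_cball[of r x] by (simp add: powr_realpow)

definition near_const :: "real \<Rightarrow> real \<Rightarrow> real" where
  "near_const N b = unit_ball_vol N * 2 powr N / (1 - 2 powr - b)"

lemma near_const_pos: "0 < b \<Longrightarrow> 0 \<le> N \<Longrightarrow> 0 < near_const N b"
  using powr_less_mono[of "-b" 0 2] by (auto simp: near_const_def intro!: divide_pos_pos mult_pos_pos)

text \<open>The shells \<open>|x - y| \<approx> r / 2 ^ k\<close> contribute multiples of \<open>(r / 2 ^ k) powr a\<close>. The constant depends on the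
  lower bound \<open>b\<close> only, so it serves all exponents \<open>\<alpha> x\<close> at once.\<close>
lemma riesz_kernel_near:
  fixes x :: "real ^ 'n"
  defines "N \<equiv> real CARD('n)"
  assumes b: "0 < b" "b \<le> a" "a \<le> N" and r: "0 < r"
  shows "(\<integral>\<^sup>+y\<in>cball x r. ennreal (norm (x - y) powr (a - N)) \<partial>lborel)
    \<le> ennreal (near_const N b * r powr a)"
proof -
  define V where "V = unit_ball_vol N"
  have V: "0 < V" by (simp add: V_def N_def)
  define \<theta> where "\<theta> = 2 powr (-b)"
  have \<theta>: "0 \<le> \<theta>" "\<theta> < 1"
    using powr_less_mono[of "-b" 0 2] b by (auto simp: \<theta>_def)
  have N: "0 \<le> N" by (simp add: N_def)
  let ?G = "\<lambda>k y. ennreal ((r / 2 ^ k) powr (a - N)) * indicator (cball x (2 * (r / 2 ^ k))) y"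
  have "(\<integral>\<^sup>+y\<in>cball x r. ennreal (norm (x - y) powr (a - N)) \<partial>lborel)
    \<le> ennreal ((V * 2 powr N * r powr a) / (1 - \<theta>))"
  \<comment> \<open>The factor 2 keeps \<open>u\<close> above one up to the boundary of the ball.\<close>
  proof (rule dyadic_nn_integral_bound[where G = ?G and u = "\<lambda>y. 2 * r / norm (x - y)"])
    show "?G k \<in> borel_measurable lborel" for k
      by (intro borel_measurable_times_ennreal borel_measurable_indicator) auto
    show "1 < 2 * r / norm (x - y)"
      if "ennreal (norm (x - y) powr (a - N)) * indicator (cball x r) y \<noteq> 0" for y
      using that r by (cases "x = y") (auto simp: indicator_def dist_norm field_simps split: if_splits)
  next
    fix y and k :: nat
    assume nz: "ennreal (norm (x - y) powr (a - N)) * indicator (cball x r) y \<noteq> 0"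
      and k: "2 ^ k < 2 * r / norm (x - y)" "2 * r / norm (x - y) \<le> 2 ^ Suc k"
    have pos: "0 < norm (x - y)" using nz by (cases "x = y") auto
    have "norm (x - y) \<le> 2 * (r / 2 ^ k)" "r / 2 ^ k \<le> norm (x - y)"
      using k pos r by (auto simp: field_simps)
    moreover from this have "norm (x - y) powr (a - N) \<le> (r / 2 ^ k) powr (a - N)"
      using r b(3) by (intro powr_mono2') auto
    ultimately show "ennreal (norm (x - y) powr (a - N)) * indicator (cball x r) y \<le> ?G k y"
      by (auto simp: indicator_def dist_norm intro!: ennreal_leI)
  next
    fix k :: nat
    have "(\<integral>\<^sup>+y. ?G k y \<partial>lborel) =
      ennreal ((r / 2 ^ k) powr (a - N)) * ennreal (V * (2 * (r / 2 ^ k)) powr N)"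
      using r by (simp add: nn_integral_cmult_indicator emeasure_cball_powr V_def N_def)
    also have "\<dots> = ennreal ((r / 2 ^ k) powr (a - N) * (V * (2 * (r / 2 ^ k)) powr N))"
      using V by (simp add: ennreal_mult)
    also have "(r / 2 ^ k) powr (a - N) * (V * (2 * (r / 2 ^ k)) powr N)
      = V * 2 powr N * (r / 2 ^ k) powr a"
    proof -
      have scale: "R powr (a - N) * (V * (2 * R) powr N) = V * 2 powr N * R powr a" if "0 < R" for R :: real
        using that by (simp add: powr_mult powr_diff)
      show ?thesis by (rule scale) (use r in simp)
    qed
    also have "\<dots> = V * 2 powr N * r powr a * (2 powr (-a)) ^ k"
      using r by (simp add: powr_div_two_power)
    also have "\<dots> \<le> V * 2 powr N * r powr a * \<theta> ^ k"
      using V b by (intro mult_left_mono power_mono) (auto simp: \<theta>_def)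
    finally show "(\<integral>\<^sup>+y. ?G k y \<partial>lborel) \<le> ennreal (V * 2 powr N * r powr a * \<theta> ^ k)"
      by (simp add: ennreal_leI)
  qed (use V \<theta> in auto)
  then show ?thesis by (simp add: near_const_def V_def \<theta>_def)
qed

section \<open>Quantitative log-Hoelder continuity\<close>

lemma powr_le_exp_powr:
  fixes t a b D :: real
  assumes "0 < t" "\<bar>a - b\<bar> * \<bar>ln t\<bar> \<le> D"
  shows "t powr a \<le> exp D * t powr b"
proof -
  have "(a - b) * ln t \<le> D"
    using assms(2) abs_ge_self[of "(a - b) * ln t"] by (simp add: abs_mult)
  then have "exp (a * ln t) \<le> exp (D + b * ln t)"
    by (simp add: algebra_simps)
  then show ?thesis using assms(1) by (simp add: powr_def exp_add)
qed

text \<open>Log-Hoelder continuity with one explicit constant for both conditions, so that several exponents can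
  share it: the product form is visibly monotone in \<open>L\<close>.\<close>
definition log_regular :: "real \<Rightarrow> (real ^ 'n \<Rightarrow> real) \<Rightarrow> real \<Rightarrow> bool" where
  "log_regular L g g0 \<longleftrightarrow>
    (\<forall>x y. \<bar>g x - g y\<bar> * ln (exp 1 + 1 / norm (x - y)) \<le> L) \<and>
    (\<forall>x. \<bar>g x - g0\<bar> * ln (exp 1 + norm x) \<le> L)"

lemma log_regular_mono: "log_regular L g g0 \<Longrightarrow> L \<le> M \<Longrightarrow> log_regular M g g0"
  unfolding log_regular_def by (meson order_trans)

lemma log_regular_nonneg:
  assumes "log_regular L g g0"
  shows "0 \<le> L"
  using assms[unfolded log_regular_def, THEN conjunct1, rule_format, of 0 0] by simp

text \<open>This is what local log-Hoelder continuity is for: a large power base \<open>t\<close> does not notice the change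
  of the exponent over a distance that is itself a negative power of \<open>t\<close>.\<close>
lemma log_regular_local:
  fixes x y :: "real ^ 'n"
  assumes g: "log_regular L g g0" and t: "1 \<le> t" and N: "0 < N"
    and xy: "norm (x - y) \<le> t powr (- 1 / N)"
  shows "t powr g y \<le> exp (L * N) * t powr g x"
proof (rule powr_le_exp_powr)
  show "\<bar>g y - g x\<bar> * \<bar>ln t\<bar> \<le> L * N"
  proof (cases "x = y")
    case False
    have "ln t / N = ln (t powr (1 / N))" using t by (simp add: ln_powr)
    also have "\<dots> \<le> ln (exp 1 + 1 / norm (x - y))"
    proof (rule ln_mono)
      have "t powr (1 / N) = 1 / t powr (- 1 / N)"
        using t by (simp add: powr_minus_divide)
      also have "\<dots> \<le> 1 / norm (x - y)"
        using xy False t by (intro divide_left_mono) auto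
      also have "\<dots> \<le> exp 1 + 1 / norm (x - y)" by simp
      finally show "t powr (1 / N) \<le> exp 1 + 1 / norm (x - y)" .
    qed (use t in \<open>auto intro: add_pos_nonneg\<close>)
    finally have "\<bar>g x - g y\<bar> * (ln t / N) \<le> \<bar>g x - g y\<bar> * ln (exp 1 + 1 / norm (x - y))"
      by (intro mult_left_mono) auto
    also have "\<dots> \<le> L" using g by (simp add: log_regular_def)
    finally show ?thesis using N t by (simp add: field_simps abs_minus_commute)
  qed (use log_regular_nonneg[OF g] N in simp)
qed (use t in simp)

lemma log_regular_local_dist:
  fixes x y :: "real ^ 'n"
  assumes g: "log_regular L g g0" and N: "1 \<le> N" and xy: "norm (x - y) \<le> 1"
  shows "norm (x - y) powr g x \<le> exp (L * N) * norm (x - y) powr g y"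
proof (cases "x = y")
  case False
  define t where "t = 1 / norm (x - y)"
  have t: "1 \<le> t" using False xy by (simp add: t_def)
  have "t powr (- 1) \<le> t powr (- 1 / N)" using t N by (intro powr_mono) auto
  then have "norm (x - y) \<le> t powr (- 1 / N)"
    using False by (simp add: t_def powr_minus_divide)
  from log_regular_local[OF g t _ this] N
  have "t powr g y \<le> exp (L * N) * t powr g x" by simp
  then show ?thesis using False by (simp add: t_def powr_divide field_simps)
qed simp

text \<open>The counterpart at infinity, for small \<open>t\<close> and at least the distance \<open>t powr (- 1 / N)\<close> from the origin.\<close>
lemma log_regular_decay:
  fixes x :: "real ^ 'n"
  assumes g: "log_regular L g g0" and t: "0 < t" "t \<le> 1" and N: "0 < N"
    and x: "t powr (- 1 / N) \<le> norm x"
  shows "\<bar>g x - g0\<bar> * \<bar>ln t\<bar> \<le> L * N"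
proof -
  have "- ln t / N = ln (t powr (- 1 / N))" using t by (simp add: ln_powr)
  also have "\<dots> \<le> ln (exp 1 + norm x)"
  proof (rule ln_mono)
    show "t powr (- 1 / N) \<le> exp 1 + norm x"
      using x exp_ge_zero[of "1::real"] by linarith
  qed (use t in \<open>auto intro: add_pos_nonneg\<close>)
  finally have "\<bar>g x - g0\<bar> * (- ln t / N) \<le> \<bar>g x - g0\<bar> * ln (exp 1 + norm x)"
    by (intro mult_left_mono) auto
  also have "\<dots> \<le> L" using g by (simp add: log_regular_def)
  finally show ?thesis using N t by (simp add: field_simps)
qed

lemma log_regular_decay_powr:
  fixes x :: "real ^ 'n"
  assumes "log_regular L g g0" "0 < t" "t \<le> 1" "0 < N" "t powr (- 1 / N) \<le> norm x"
  shows "t powr g x \<le> exp (L * N) * t powr g0" "t powr g0 \<le> exp (L * N) * t powr g x"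
  using log_regular_decay[OF assms] assms(2)
  by (auto intro!: powr_le_exp_powr simp: abs_minus_commute)

lemma log_regular_compose_lipschitz:
  assumes g: "log_regular L g g0" and h: "log_regular L h h0"
    and K: "0 \<le> K"
    and xy: "\<And>x y. \<bar>k x - k y\<bar> \<le> K * (\<bar>g x - g y\<bar> + \<bar>h x - h y\<bar>)"
    and x0: "\<And>x. \<bar>k x - k0\<bar> \<le> K * (\<bar>g x - g0\<bar> + \<bar>h x - h0\<bar>)"
  shows "log_regular (2 * K * L) k k0"
  unfolding log_regular_def
proof (intro conjI allI)
  have comb: "c * w \<le> 2 * K * L"
    if "c \<le> K * (a + b)" "a * w \<le> L" "b * w \<le> L" "0 \<le> w" for a b c w :: real
  proof -
    have "c * w \<le> K * (a + b) * w" using that by (intro mult_right_mono) auto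
    also have "\<dots> = K * (a * w + b * w)" by (simp add: algebra_simps)
    also have "\<dots> \<le> K * (L + L)" using that K by (intro mult_left_mono add_mono) auto
    finally show ?thesis by (simp add: algebra_simps)
  qed
  have ln0: "0 \<le> ln (exp 1 + s)" if "0 \<le> s" for s :: real
    using that exp_ge_add_one_self[of 1] by (intro ln_ge_zero) linarith
  show "\<bar>k x - k y\<bar> * ln (exp 1 + 1 / norm (x - y)) \<le> 2 * K * L" for x y
    using g h by (intro comb[OF xy] ln0) (auto simp: log_regular_def)
  show "\<bar>k x - k0\<bar> * ln (exp 1 + norm x) \<le> 2 * K * L" for x
    using g h by (intro comb[OF x0] ln0) (auto simp: log_regular_def)
qed

section \<open>The Sobolev conjugate exponent\<close>

text \<open>With \<open>a\<close> and \<open>b\<close> in the role of \<open>p x\<close> and \<open>\<alpha> x\<close>, \<open>conj_exp\<close> is the Sobolev conjugate of \<open>a\<close> and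
  \<open>conj_ratio\<close> is its quotient by \<open>a\<close>. As functions of numbers they apply to the values at infinity too.\<close>
definition conj_ratio :: "real \<Rightarrow> real \<Rightarrow> real \<Rightarrow> real" where
  "conj_ratio N a b = N / (N - b * a)"

definition conj_exp :: "real \<Rightarrow> real \<Rightarrow> real \<Rightarrow> real" where
  "conj_exp N a b = N * a / (N - b * a)"

lemma conj_exp_eq: "conj_exp N a b = a * conj_ratio N a b"
  by (simp add: conj_exp_def conj_ratio_def)

lemma conj_ratio_bounds:
  assumes "0 < a" "a \<le> P" "0 < b" "b \<le> A" "A * P < N"
  shows "1 \<le> conj_ratio N a b" "conj_ratio N a b \<le> N / (N - A * P)"
proof -
  have ba: "b * a \<le> A * P" "0 < b * a" using assms by (auto intro!: mult_mono)
  have "0 < N" using ba assms by linarith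
  with ba assms show "1 \<le> conj_ratio N a b"
    by (simp add: conj_ratio_def)
  show "conj_ratio N a b \<le> N / (N - A * P)"
    unfolding conj_ratio_def using ba assms \<open>0 < N\<close>
    by (intro divide_left_mono mult_pos_pos) auto
qed

text \<open>The two identities behind the choice of the radius \<open>t powr (- q / N)\<close>: the first makes the near part of
  the potential, the second its far part, of order \<open>t\<close>.\<close>
lemma conj_exp_relations:
  assumes "0 < a" "0 < b" "b * a < N"
  shows "conj_ratio N a b - conj_exp N a b * b / N = 1"
    "conj_exp N a b * (b - N / a) = - N"
proof -
  define D where "D = N - b * a"
  have D: "0 < D" "0 < N" "N = D + b * a"
    using less_trans[OF mult_pos_pos[OF assms(2,1)] assms(3)] assms(3) unfolding D_def by auto
  have "conj_ratio N a b - conj_exp N a b * b / N = N / D - a * b / D"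
    using D(1,2) by (simp add: conj_ratio_def conj_exp_def flip: D_def)
  also have "\<dots> = (N - b * a) / D" by (simp add: diff_divide_distrib mult.commute)
  finally have "conj_ratio N a b - conj_exp N a b * b / N = (N - b * a) / D" .
  then show "conj_ratio N a b - conj_exp N a b * b / N = 1"
    using D(1) by (simp add: D_def)
  have "a * (b - N / a) = b * a - N" using assms by (simp add: field_simps)
  then have "conj_exp N a b * (b - N / a) = N * (b * a - N) / D"
    by (simp add: conj_exp_def D_def mult.assoc)
  also have "b * a - N = - D" by (simp add: D_def)
  finally show "conj_exp N a b * (b - N / a) = - N" using D(1) by simp
qed

text \<open>The conjugate exponents inherit log-Hoelder continuity through this Lipschitz bound. It holds because
  \<open>A * P < N\<close> keeps the denominator away from zero.\<close>
lemma conj_lipschitz: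
  assumes "0 < a" "a \<le> P" "0 < b" "b \<le> A"
    "0 < a'" "a' \<le> P" "0 < b'" "b' \<le> A" "A * P < N"
  defines "E \<equiv> N / (N - A * P)"
  defines "K \<equiv> E + P * (E * E * (A + P))"
  assumes N: "1 \<le> N" "1 \<le> P"
  shows "\<bar>conj_ratio N a b - conj_ratio N a' b'\<bar> \<le> K * (\<bar>a - a'\<bar> + \<bar>b - b'\<bar>)"
    and "\<bar>conj_exp N a b - conj_exp N a' b'\<bar> \<le> K * (\<bar>a - a'\<bar> + \<bar>b - b'\<bar>)"
proof -
  define e where "e = conj_ratio N a b"
  define e' where "e' = conj_ratio N a' b'"
  define d where "d = \<bar>a - a'\<bar> + \<bar>b - b'\<bar>"
  have e: "1 \<le> e" "e \<le> E" "1 \<le> e'" "e' \<le> E"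
    unfolding e_def e'_def E_def using assms(1-9)
    by (auto intro: conj_ratio_bounds)
  have D: "b * a < N" "b' * a' < N"
    using assms mult_mono[of b A a P] mult_mono[of b' A a' P] by auto
  have "b * a - b' * a' = b * (a - a') + a' * (b - b')" by (simp add: algebra_simps)
  then have "\<bar>b * a - b' * a'\<bar> \<le> \<bar>b * (a - a')\<bar> + \<bar>a' * (b - b')\<bar>" by simp
  also have "\<dots> \<le> A * \<bar>a - a'\<bar> + P * \<bar>b - b'\<bar>"
    using assms by (auto simp: abs_mult intro!: add_mono mult_right_mono)
  also have "\<dots> \<le> (A + P) * d"
    unfolding d_def using assms by (simp add: algebra_simps)
  finally have ba: "\<bar>b * a - b' * a'\<bar> \<le> (A + P) * d" .
  have recip: "N / D - N / D' = N / D * (N / D') * (D' - D) / N" if "D \<noteq> 0" "D' \<noteq> 0" for D D'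
    using that N by (simp add: field_simps)
  have "e - e' = e * e' * (b * a - b' * a') / N"
    unfolding e_def e'_def conj_ratio_def using recip[of "N - b * a" "N - b' * a'"] D by simp
  then have "\<bar>e - e'\<bar> = e * e' * \<bar>b * a - b' * a'\<bar> / N"
    using e N by (simp add: abs_mult)
  also have "\<dots> \<le> e * e' * \<bar>b * a - b' * a'\<bar> / 1"
    using e N by (intro divide_left_mono) auto
  also have "\<dots> \<le> E * E * ((A + P) * d)"
    using e ba by (simp, intro mult_mono) auto
  finally have ee: "\<bar>e - e'\<bar> \<le> (E * E * (A + P)) * d" by (simp add: algebra_simps)
  have d: "0 \<le> d" by (simp add: d_def)
  have X: "0 \<le> E * E * (A + P)" using assms e by auto
  have "(E * E * (A + P)) * d \<le> (P * (E * E * (A + P))) * d"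
    using X N d mult_right_mono[of 1 P "E * E * (A + P)"] by (intro mult_right_mono) auto
  also have "\<dots> \<le> K * d" unfolding K_def using e d by (intro mult_right_mono) auto
  finally show "\<bar>conj_ratio N a b - conj_ratio N a' b'\<bar> \<le> K * (\<bar>a - a'\<bar> + \<bar>b - b'\<bar>)"
    using ee by (simp add: e_def e'_def d_def)
  have "a * e - a' * e' = (a - a') * e + a' * (e - e')" by (simp add: algebra_simps)
  then have "\<bar>a * e - a' * e'\<bar> \<le> \<bar>(a - a') * e\<bar> + \<bar>a' * (e - e')\<bar>" by simp
  also have "\<dots> \<le> d * E + P * ((E * E * (A + P)) * d)"
    unfolding abs_mult using assms e ee by (intro add_mono mult_mono) (auto simp: d_def)
  also have "\<dots> = K * d" by (simp add: K_def algebra_simps)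
  finally show "\<bar>conj_exp N a b - conj_exp N a' b'\<bar> \<le> K * (\<bar>a - a'\<bar> + \<bar>b - b'\<bar>)"
    by (simp add: conj_exp_eq e_def e'_def d_def)
qed

section \<open>Averages over balls and the tail of the potential\<close>

text \<open>The dyadic series converges because the measures decay like \<open>2 powr (- b * k)\<close> with \<open>b > 1\<close>, faster
  than the heights \<open>s * 2 ^ k\<close> grow.\<close>
lemma nn_integral_level_sum:
  fixes f :: "'a \<Rightarrow> real"
  assumes f[measurable]: "f \<in> borel_measurable M" and S[measurable]: "S \<in> sets M"
    and s: "0 < s" and b: "1 < b" and D: "0 \<le> D"
    and lev: "\<And>k. emeasure M {y \<in> S. s * 2 ^ k < f y} \<le> ennreal (D * (2 powr - b) ^ k)"
    and sp: "space M = UNIV"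
  shows "(\<integral>\<^sup>+y\<in>{y \<in> S. s < f y}. ennreal (f y) \<partial>M) \<le> ennreal (2 * s * D / (1 - 2 powr (1 - b)))"
proof (rule dyadic_nn_integral_bound[where u = "\<lambda>y. f y / s" and
      G = "\<lambda>k y. ennreal (s * 2 ^ Suc k) * indicator {y \<in> S. s * 2 ^ k < f y} y"])
  have [measurable]: "{y \<in> S. c < f y} \<in> sets M" for c
  proof -
    have "{y \<in> S. c < f y} = S \<inter> {y \<in> space M. c < f y}" using sp by auto
    then show ?thesis by simp
  qed
  show "(\<lambda>y. ennreal (s * 2 ^ Suc k) * indicator {y \<in> S. s * 2 ^ k < f y} y) \<in> borel_measurable M" for k
    by (intro borel_measurable_times_ennreal borel_measurable_indicator) auto
  have "(\<integral>\<^sup>+y. ennreal (s * 2 ^ Suc k) * indicator {y \<in> S. s * 2 ^ k < f y} y \<partial>M)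
    = ennreal (s * 2 ^ Suc k) * emeasure M {y \<in> S. s * 2 ^ k < f y}" for k
    by (subst nn_integral_cmult_indicator) auto
  also have "\<dots>k \<le> ennreal (s * 2 ^ Suc k) * ennreal (D * (2 powr - b) ^ k)" for k
    by (intro mult_left_mono lev) auto
  also have "\<dots>k = ennreal (2 * s * D * (2 powr (1 - b)) ^ k)" for k
    using s D by (simp add: ennreal_mult[symmetric] powr_diff powr_minus power_mult_distrib
        power_divide power_inverse field_simps)
  finally show "(\<integral>\<^sup>+y. ennreal (s * 2 ^ Suc k) * indicator {y \<in> S. s * 2 ^ k < f y} y \<partial>M)
    \<le> ennreal (2 * s * D * (2 powr (1 - b)) ^ k)" for k .
qed (use s b D in \<open>auto simp: field_simps powr_less_one indicator_def split: if_splits intro!: ennreal_leI\<close>)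

text \<open>The situation after the normalisation: \<open>f\<close> is a Borel representative of the absolute
  value of the given function, the essential bounds hold everywhere, \<open>pinf\<close> and \<open>ainf\<close> are the values of \<open>p\<close> and \<open>\<alpha>\<close> at infinity,
  one constant \<open>L\<close> serves \<open>p\<close>, \<open>\<alpha>\<close> and both conjugate exponents, and both weak norms appear as modular inequalities.\<close>
locale weak_riesz =
  fixes p \<alpha> f :: "real ^ 'n \<Rightarrow> real" and N pm P am A L pinf ainf C :: real
  assumes N_def: "N = real CARD('n)"
    and pm: "1 < pm" and p_bounds: "\<And>x. pm \<le> p x" "\<And>x. p x \<le> P"
    and am: "0 < am" and \<alpha>_bounds: "\<And>x. am \<le> \<alpha> x" "\<And>x. \<alpha> x \<le> A"
    and pinf: "pm \<le> pinf" "pinf \<le> P" and ainf: "am \<le> ainf" "ainf \<le> A"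
    and AP: "A * P < N"
    and p_reg: "log_regular L p pinf" and \<alpha>_reg: "log_regular L \<alpha> ainf"
    and q_reg: "log_regular L (\<lambda>x. conj_exp N (p x) (\<alpha> x)) (conj_exp N pinf ainf)"
    and e_reg: "log_regular L (\<lambda>x. conj_ratio N (p x) (\<alpha> x)) (conj_ratio N pinf ainf)"
    and p_meas[measurable]: "p \<in> borel_measurable borel"
    and \<alpha>_meas[measurable]: "\<alpha> \<in> borel_measurable borel"
    and f_meas[measurable]: "f \<in> borel_measurable borel"
    and f_nonneg: "\<And>x. 0 \<le> f x"
    and C: "0 \<le> C"
    and weak_p: "\<And>t. 0 < t \<Longrightarrow>
      (\<integral>\<^sup>+y\<in>{y. t < f y}. ennreal (t powr p y) \<partial>lborel) \<le> ennreal C"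
    and weak_q: "\<And>t. 0 < t \<Longrightarrow>
      (\<integral>\<^sup>+y\<in>{y. t < f y powr (1 / conj_ratio N (p y) (\<alpha> y))}.
        ennreal (t powr conj_exp N (p y) (\<alpha> y)) \<partial>lborel) \<le> ennreal C"
begin

abbreviation "e x \<equiv> conj_ratio N (p x) (\<alpha> x)"
abbreviation "q x \<equiv> conj_exp N (p x) (\<alpha> x)"
abbreviation "einf \<equiv> conj_ratio N pinf ainf"
abbreviation "qinf \<equiv> conj_exp N pinf ainf"
abbreviation "V \<equiv> unit_ball_vol N"

text \<open>The factor that is lost when an exponent is moved to a nearby point or to infinity.\<close>
abbreviation "X \<equiv> exp (L * N)"

lemma N_ge_1: "1 \<le> N" using N_def by (simp add: Suc_leI)

lemma V_pos: "0 < V" using N_ge_1 by simp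

lemma L_nonneg: "0 \<le> L" by (rule log_regular_nonneg[OF p_reg])

lemma X_ge_1: "1 \<le> X" using L_nonneg N_ge_1 by simp

lemma prod_bounds: "\<alpha> x * p x < N" "ainf * pinf < N" "\<alpha> x < N" "A < N" "A < N / P" "1 < P"
proof -
  have A: "0 < A" using am \<alpha>_bounds[of x] by linarith
  have P: "1 < P" using pm pinf by linarith
  show "\<alpha> x * p x < N" "ainf * pinf < N"
    using mult_mono[OF \<alpha>_bounds(2)[of x] p_bounds(2)[of x]] p_bounds(1)[of x] pm
      mult_mono[OF ainf(2) pinf(2)] pinf A AP by auto
  have "A < A * P" using A P by simp
  with AP show "A < N" by simp
  with \<alpha>_bounds(2)[of x] show "\<alpha> x < N" by simp
  show "A < N / P" using P AP by (simp add: field_simps)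
  show "1 < P" by fact
qed

lemma positivity [simp]: "0 < p x" "0 < \<alpha> x" "0 < pinf" "0 < ainf" "0 < N" "1 < p x" "1 < pinf"
  "0 \<le> p x" "0 \<le> \<alpha> x" "0 \<le> pinf" "0 \<le> ainf" "0 \<le> N" "p x \<noteq> 0" "pinf \<noteq> 0" "N \<noteq> 0" "1 \<le> p x" "1 \<le> pinf"
  using p_bounds(1)[of x] \<alpha>_bounds(1)[of x] pm am pinf ainf N_ge_1 by auto

lemma cball_measure: "0 < r \<Longrightarrow> emeasure lborel (cball (x :: real ^ 'n) r) = ennreal (V * r powr N)"
  by (simp add: emeasure_cball_powr N_def)

text \<open>The modular inequality at level \<open>s\<close> would give the power \<open>- P\<close> at worst. The better power \<open>- pinf\<close> comes
  from the decay of \<open>p\<close> outside a ball of measure \<open>V / s\<close>, and \<open>1 / s\<close> is below the claimed bound anyway.\<close>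
lemma superlevel_measure_below_one:
  assumes s: "0 < s" "s \<le> 1"
  shows "emeasure lborel {y. s < f y} \<le> ennreal ((V + C * X) * s powr (- pinf))"
proof -
  \<comment> \<open>Outside the ball of radius \<open>?R\<close> the decay of \<open>p\<close> applies at the base \<open>s\<close>.\<close>
  let ?R = "s powr (- 1 / N)"
  let ?B = "{y. s < f y \<and> ?R < norm y}"
  have "emeasure lborel {y. s < f y} \<le> emeasure lborel (cball 0 ?R \<union> ?B)"
    by (intro emeasure_mono) auto
  also have "\<dots> \<le> emeasure lborel (cball (0 :: real ^ 'n) ?R) + emeasure lborel ?B"
    by (intro emeasure_subadditive) auto
  also have "\<dots> \<le> ennreal (V * s powr (- pinf)) + ennreal (C / (s powr pinf / X))"
  proof (intro add_mono)
    have "emeasure lborel (cball (0 :: real ^ 'n) ?R) = ennreal (V * s powr (- 1))"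
      using s by (simp add: cball_measure powr_powr)
    also have "\<dots> \<le> ennreal (V * s powr (- pinf))"
      using s V_pos by (intro ennreal_leI mult_left_mono powr_mono') (auto simp: less_imp_le)
    finally show "emeasure lborel (cball (0 :: real ^ 'n) ?R) \<le> ennreal (V * s powr (- pinf))" .
    show "emeasure lborel ?B \<le> ennreal (C / (s powr pinf / X))"
    proof (rule emeasure_le_of_weight[OF weak_p[OF s(1)]])
      fix y assume "y \<in> ?B"
      then have "s powr pinf \<le> X * s powr p y"
        using s by (intro log_regular_decay_powr(2)[OF p_reg]) auto
      then show "s powr pinf / X \<le> s powr p y" by (simp add: field_simps)
    qed (use s C in auto)
  qed
  also have "\<dots> = ennreal ((V + C * X) * s powr (- pinf))"
    using s C V_pos by (simp add: ennreal_plus[symmetric] powr_minus field_simps del: ennreal_plus)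
  finally show ?thesis .
qed

lemma superlevel_measure_above_one:
  assumes s: "1 \<le> s"
  shows "emeasure lborel {y. s < f y} \<le> ennreal (C * s powr (- pm))"
proof -
  have "emeasure lborel {y. s < f y} \<le> ennreal (C / s powr pm)"
    using s C p_bounds by (intro emeasure_le_of_weight[OF weak_p]) (auto intro!: powr_mono)
  then show ?thesis using s by (simp add: powr_minus_divide)
qed

lemma superlevel_measure_dyadic:
  assumes s: "0 < s" "s \<le> 1"
  shows "emeasure lborel {y. s * 2 ^ k < f y}
    \<le> ennreal ((V + C * X) * s powr (- pinf) * (2 powr - pm) ^ k)"
proof -
  have H: "C \<le> V + C * X" "0 \<le> V + C * X"
    using C V_pos mult_left_mono[OF X_ge_1 C] by (linarith, simp)
  show ?thesis
  proof (cases "s * 2 ^ k \<le> 1")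
    case True
    have "emeasure lborel {y. s * 2 ^ k < f y} \<le> ennreal ((V + C * X) * (s * 2 ^ k) powr (- pinf))"
      using s True by (intro superlevel_measure_below_one) auto
    also have "(s * 2 ^ k) powr (- pinf) = s powr (- pinf) * (2 powr - pinf) ^ k"
      using s by (simp add: powr_mult_two_power)
    also have "(V + C * X) * (s powr (- pinf) * (2 powr - pinf) ^ k)
        \<le> (V + C * X) * (s powr (- pinf) * (2 powr - pm) ^ k)"
      using H pinf by (intro mult_left_mono power_mono powr_mono) auto
    finally show ?thesis by (simp add: mult.assoc ennreal_leI)
  next
    case False
    then have "emeasure lborel {y. s * 2 ^ k < f y} \<le> ennreal (C * (s * 2 ^ k) powr (- pm))"
      by (intro superlevel_measure_above_one) auto
    also have "(s * 2 ^ k) powr (- pm) = s powr (- pm) * (2 powr - pm) ^ k"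
      using s by (simp add: powr_mult_two_power)
    also have "C * (s powr (- pm) * (2 powr - pm) ^ k)
        \<le> (V + C * X) * (s powr (- pinf) * (2 powr - pm) ^ k)"
      using H s pinf by (intro mult_mono powr_mono') auto
    finally show ?thesis by (simp add: mult.assoc ennreal_leI)
  qed
qed

lemma two_powr_less_1: "2 powr (1 - pm) < 1"
  using pm by (simp add: powr_less_one)

lemma integral_above_level_below_one:
  assumes s: "0 < s" "s \<le> 1"
  shows "(\<integral>\<^sup>+y\<in>{y. s < f y}. ennreal (f y) \<partial>lborel)
    \<le> ennreal (2 * (V + C * X) / (1 - 2 powr (1 - pm)) * s powr (1 - pinf))"
proof -
  have "(\<integral>\<^sup>+y\<in>{y \<in> UNIV. s < f y}. ennreal (f y) \<partial>lborel)
    \<le> ennreal (2 * s * ((V + C * X) * s powr (- pinf)) / (1 - 2 powr (1 - pm)))"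
    using s superlevel_measure_dyadic[OF s] pm V_pos C by (intro nn_integral_level_sum) auto
  also have "2 * s * ((V + C * X) * s powr (- pinf)) / (1 - 2 powr (1 - pm))
    = 2 * (V + C * X) / (1 - 2 powr (1 - pm)) * s powr (1 - pinf)"
    using s by (simp add: powr_diff powr_minus field_simps)
  finally show ?thesis by simp
qed

definition avg_const :: real where
  "avg_const = V + 2 * (V + C * X) / (1 - 2 powr (1 - pm))"

lemma avg_const_pos: "0 < avg_const"
  unfolding avg_const_def using V_pos C two_powr_less_1
  by (intro add_pos_nonneg divide_nonneg_pos) auto

text \<open>The size of the mean of \<open>f\<close> over the ball of radius \<open>r\<close> about \<open>x\<close>: it is the reciprocal of the
  order of the \<open>p\<close>-norm of the indicator of that ball, which follows \<open>p x\<close> on small balls and the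
  value at infinity on large ones.\<close>
definition ball_growth :: "real ^ 'n \<Rightarrow> real \<Rightarrow> real" where
  "ball_growth x r = r powr (- N / (if r \<le> 1 then p x else pinf))"

lemma split_at_level:
  assumes [measurable]: "S \<in> sets lborel" and s: "0 \<le> s"
  shows "(\<integral>\<^sup>+y\<in>S. ennreal (f y) \<partial>lborel) \<le> ennreal s * emeasure lborel S
    + (\<integral>\<^sup>+y\<in>{y \<in> S. s < f y}. ennreal (f y) \<partial>lborel)"
proof -
  have "(\<integral>\<^sup>+y\<in>S. ennreal (f y) \<partial>lborel)
    \<le> (\<integral>\<^sup>+y. ennreal s * indicator S y + ennreal (f y) * indicator {y \<in> S. s < f y} y \<partial>lborel)"
    by (intro nn_integral_mono) (auto simp: indicator_def intro: ennreal_leI)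
  also have "\<dots> = ennreal s * emeasure lborel S
    + (\<integral>\<^sup>+y\<in>{y \<in> S. s < f y}. ennreal (f y) \<partial>lborel)"
    using assms(1) by (subst nn_integral_add) (auto simp: nn_integral_cmult_indicator)
  finally show ?thesis .
qed

text \<open>The integral is split at the height \<open>s = ball_growth x r\<close>, where the trivial bound for the lower part
  has the claimed size. On a small ball \<open>s \<ge> 1\<close>, and the upper part uses \<open>s powr p y \<approx> s powr p x\<close>; for the
  higher levels \<open>s * 2 ^ k\<close> only the factor \<open>s\<close> has to be compared, as \<open>pm\<close> is good enough for \<open>2 ^ k\<close>. On a
  large ball \<open>s \<le> 1\<close>, and the upper part is bounded by its integral over the whole space.\<close>
lemma integral_cball_le_growth:
  fixes x :: "real ^ 'n"
  assumes r: "0 < r"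
  shows "(\<integral>\<^sup>+y\<in>cball x r. ennreal (f y) \<partial>lborel) \<le> ennreal (avg_const * (r powr N * ball_growth x r))"
proof -
  define s where "s = ball_growth x r"
  have s: "0 < s" using r by (simp add: s_def ball_growth_def)
  let ?T = "1 - 2 powr (1 - pm)"
  have T: "0 < ?T" using two_powr_less_1 by simp
  have H: "0 \<le> V + C * X" using V_pos C by simp
  have tail: "(\<integral>\<^sup>+y\<in>{y \<in> cball x r. s < f y}. ennreal (f y) \<partial>lborel)
    \<le> ennreal (2 * (V + C * X) / ?T * (r powr N * s))"
  proof (cases "r \<le> 1")
    case True
    have s1: "s = r powr (- N / p x)" using True by (simp add: s_def ball_growth_def)
    have s_ge: "1 \<le> s" using r True powr_mono'[of "- N / p x" 0 r] by (simp add: s1)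
    have "(\<integral>\<^sup>+y\<in>{y \<in> cball x r. s < f y}. ennreal (f y) \<partial>lborel)
      \<le> ennreal (2 * s * (C * X * r powr N) / ?T)"
    proof (rule nn_integral_level_sum)
      fix k :: nat
      let ?m = "r powr (- N) / X * (2 powr pm) ^ k"
      have "emeasure lborel {y \<in> cball x r. s * 2 ^ k < f y} \<le> ennreal (C / ?m)"
      proof (rule emeasure_le_of_weight[OF weak_p])
        fix y assume y: "y \<in> {y \<in> cball x r. s * 2 ^ k < f y}"
        have "r powr 1 \<le> r powr (1 / p x)"
          using r True by (intro powr_mono') auto
        also have "\<dots> = s powr (- 1 / N)" using r by (simp add: s1 powr_powr)
        finally have "norm (y - x) \<le> s powr (- 1 / N)"
          using y r by (auto simp: dist_norm norm_minus_commute)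
        then have "s powr p x \<le> X * s powr p y"
          using s_ge by (intro log_regular_local[OF p_reg]) auto
        moreover have "s powr p x = r powr (- N)" using r by (simp add: s1 powr_powr)
        ultimately have "r powr (- N) / X \<le> s powr p y" by (simp add: field_simps)
        moreover have "(2 powr pm) ^ k \<le> (2 powr p y) ^ k"
          using p_bounds by (intro power_mono powr_mono) auto
        ultimately have "?m \<le> s powr p y * (2 powr p y) ^ k"
          by (intro mult_mono) auto
        then show "?m \<le> (s * 2 ^ k) powr p y" using s by (simp add: powr_mult_two_power)
      qed (use s r C in auto)
      also have "C / ?m = C * X * r powr N * (2 powr - pm) ^ k"
        using r by (simp add: powr_minus power_inverse field_simps)
      finally show "emeasure lborel {y \<in> cball x r. s * 2 ^ k < f y}
        \<le> ennreal (C * X * r powr N * (2 powr - pm) ^ k)" .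
    qed (use s pm C in auto)
    also have "\<dots> \<le> ennreal (2 * s * ((V + C * X) * r powr N) / ?T)"
      using s T V_pos by (intro ennreal_leI divide_right_mono mult_left_mono mult_right_mono) auto
    finally show ?thesis by (simp add: algebra_simps)
  next
    case False
    have s1: "s = r powr (- N / pinf)" using False by (simp add: s_def ball_growth_def)
    have s_le: "s \<le> 1" using r False powr_mono[of "- N / pinf" 0 r] by (simp add: s1)
    have "(\<integral>\<^sup>+y\<in>{y \<in> cball x r. s < f y}. ennreal (f y) \<partial>lborel)
      \<le> (\<integral>\<^sup>+y\<in>{y. s < f y}. ennreal (f y) \<partial>lborel)"
      by (intro nn_integral_mono) (auto simp: indicator_def)
    also have "\<dots> \<le> ennreal (2 * (V + C * X) / ?T * s powr (1 - pinf))"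
      by (rule integral_above_level_below_one[OF s s_le])
    also have "s powr (1 - pinf) = s powr (- pinf) * s"
      using s by (simp add: powr_diff powr_minus field_simps)
    also have "s powr (- pinf) = r powr N" using r by (simp add: s1 powr_powr)
    finally show ?thesis .
  qed
  have "(\<integral>\<^sup>+y\<in>cball x r. ennreal (f y) \<partial>lborel) \<le> ennreal s * emeasure lborel (cball x r)
    + (\<integral>\<^sup>+y\<in>{y \<in> cball x r. s < f y}. ennreal (f y) \<partial>lborel)"
    using s by (intro split_at_level) auto
  also have "\<dots> \<le> ennreal (s * (V * r powr N)) + ennreal (2 * (V + C * X) / ?T * (r powr N * s))"
    using tail s r V_pos by (intro add_mono) (auto simp: cball_measure ennreal_mult)
  also have "\<dots> = ennreal (avg_const * (r powr N * s))"
  proof -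
    have "0 \<le> s * (V * r powr N)" "0 \<le> 2 * (V + C * X) / ?T * (r powr N * s)"
      using s T H V_pos by (auto intro!: mult_nonneg_nonneg divide_nonneg_pos)
    then show ?thesis by (subst ennreal_plus[symmetric]) (auto simp: avg_const_def algebra_simps)
  qed
  finally show ?thesis by (simp add: s_def)
qed

text \<open>Multiplied by \<open>r powr (N / P - A)\<close>, the left-hand function of the radius is nonincreasing: it is a
  power of \<open>r\<close> with a nonpositive exponent on either side of \<open>r = 1\<close>, and it is continuous there.\<close>
lemma ball_growth_decay:
  assumes r: "0 < r" and m: "1 \<le> m"
  shows "(r * m) powr \<alpha> x * ball_growth x (r * m)
    \<le> r powr \<alpha> x * ball_growth x r * m powr (A - N / P)"
proof -
  define c where "c = N / P - A"
  have c: "0 < c" using prod_bounds(5) by (simp add: c_def)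
  \<comment> \<open>The power of the radius that remains after the factor of exponent \<open>- c\<close> has been split off.\<close>
  define g where "g = (\<lambda>t :: real. (if t \<le> 1 then \<alpha> x - N / p x else \<alpha> x - N / pinf) + c)"
  have P: "0 < P" using prod_bounds(6) by simp
  have "N / P \<le> N / p x" "N / P \<le> N / pinf"
    using p_bounds[of x] pinf by (auto intro!: divide_left_mono simp: P)
  then have g: "g t \<le> 0" for t using \<alpha>_bounds(2)[of x] by (auto simp: g_def c_def)
  have val: "t powr \<alpha> x * ball_growth x t = t powr g t * t powr (- c)" if "0 < t" for t
    using that by (auto simp: ball_growth_def g_def simp flip: powr_add)
  have "(r * m) powr g (r * m) \<le> r powr g r"
  proof (cases "r \<le> 1")
    case r1: True
    show ?thesis
    proof (cases "r * m \<le> 1")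
      case True
      then have "g (r * m) = g r" using r1 by (simp add: g_def)
      then show ?thesis using r m g[of r] by (auto intro!: powr_mono2')
    next
      case False
      then have "(r * m) powr g (r * m) \<le> (r * m) powr 0" using g by (intro powr_mono) auto
      also have "\<dots> \<le> r powr 0" using r m by simp
      also have "\<dots> \<le> r powr g r" using r r1 g by (intro powr_mono') auto
      finally show ?thesis .
    qed
  next
    case False
    moreover have "r \<le> r * m" using r m by simp
    ultimately have "\<not> r * m \<le> 1" by linarith
    with False have "g (r * m) = g r" by (simp add: g_def)
    then show ?thesis using r m g[of r] by (auto intro!: powr_mono2')
  qed
  then have "(r * m) powr g (r * m) * (r * m) powr (- c) \<le> r powr g r * (r * m) powr (- c)"
    by (intro mult_right_mono) auto
  also have "\<dots> = r powr g r * r powr (- c) * m powr (- c)"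
    using r m by (simp add: powr_mult)
  finally show ?thesis using r m val[of r] val[of "r * m"] by (simp add: c_def)
qed

definition far_const :: real where
  "far_const = avg_const * 2 powr N / (1 - 2 powr (A - N / P))"

lemma two_powr_far_less_1: "2 powr (A - N / P) < 1"
  using prod_bounds(5) by (simp add: powr_less_one)

lemma far_const_pos: "0 < far_const"
  using avg_const_pos two_powr_far_less_1 by (simp add: far_const_def)

lemma integral_far_le_growth:
  fixes x :: "real ^ 'n"
  assumes d: "0 < d"
  shows "(\<integral>\<^sup>+y\<in>{y. d < norm (x - y)}. ennreal (f y * norm (x - y) powr (\<alpha> x - N)) \<partial>lborel)
    \<le> ennreal (far_const * (d powr \<alpha> x * ball_growth x d))"
proof -
  define a where "a = \<alpha> x"
  define w where "w = d powr a * ball_growth x d"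
  define \<theta> where "\<theta> = 2 powr (A - N / P)"
  have \<theta>: "0 \<le> \<theta>" "\<theta> < 1" using two_powr_far_less_1 by (auto simp: \<theta>_def)
  have a: "0 < a" "a < N" using prod_bounds(3)[of x] by (auto simp: a_def)
  have w: "0 \<le> w" by (simp add: w_def ball_growth_def)
  let ?G = "\<lambda>k y. ennreal ((d * 2 ^ k) powr (a - N)) *
    (ennreal (f y) * indicator (cball x (d * 2 ^ Suc k)) y)"
  have "(\<integral>\<^sup>+y\<in>{y. d < norm (x - y)}. ennreal (f y * norm (x - y) powr (a - N)) \<partial>lborel)
    \<le> ennreal ((avg_const * 2 powr N * w) / (1 - \<theta>))"
  proof (rule dyadic_nn_integral_bound[where G = ?G and u = "\<lambda>y. norm (x - y) / d"])
    show "?G k \<in> borel_measurable lborel" for k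
      by (intro borel_measurable_times_ennreal borel_measurable_indicator) auto
    show "1 < norm (x - y) / d"
      if "ennreal (f y * norm (x - y) powr (a - N)) * indicator {y. d < norm (x - y)} y \<noteq> 0" for y
      using that d by (auto simp: indicator_def field_simps split: if_splits)
  next
    fix y and k :: nat
    assume k: "2 ^ k < norm (x - y) / d" "norm (x - y) / d \<le> 2 ^ Suc k"
    have k': "d * 2 ^ k \<le> norm (x - y)" "norm (x - y) \<le> d * 2 ^ Suc k"
      using k d by (auto simp: field_simps)
    have "norm (x - y) powr (a - N) \<le> (d * 2 ^ k) powr (a - N)"
      using k' d a by (intro powr_mono2') auto
    then have "f y * norm (x - y) powr (a - N) \<le> (d * 2 ^ k) powr (a - N) * f y"
      using f_nonneg[of y] by (subst mult.commute) (rule mult_right_mono)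
    then show "ennreal (f y * norm (x - y) powr (a - N)) * indicator {y. d < norm (x - y)} y \<le> ?G k y"
      using k'(2) f_nonneg[of y]
      by (auto simp: indicator_def dist_norm simp flip: ennreal_mult intro!: ennreal_leI)
  next
    fix k :: nat
    let ?r = "d * 2 ^ k" and ?r' = "d * 2 ^ Suc k"
    have r: "0 < ?r" "0 < ?r'" using d by auto
    have "(\<integral>\<^sup>+y. ?G k y \<partial>lborel) =
      ennreal (?r powr (a - N)) * (\<integral>\<^sup>+y\<in>cball x ?r'. ennreal (f y) \<partial>lborel)"
      by (intro nn_integral_cmult borel_measurable_times_ennreal borel_measurable_indicator) auto
    also have "\<dots> \<le> ennreal (?r powr (a - N)) * ennreal (avg_const * (?r' powr N * ball_growth x ?r'))"
      using r by (intro mult_left_mono integral_cball_le_growth) auto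
    also have "\<dots> = ennreal (?r powr (a - N) * (avg_const * (?r' powr N * ball_growth x ?r')))"
      using avg_const_pos by (subst ennreal_mult) (auto simp: ball_growth_def)
    also have "?r powr (a - N) * (avg_const * (?r' powr N * ball_growth x ?r'))
      = avg_const * 2 powr N * 2 powr (- a) * (?r' powr a * ball_growth x ?r')"
    proof -
      have scale: "R powr (a - N) * (B * ((R * 2) powr N * W))
        = B * 2 powr N * 2 powr (- a) * ((R * 2) powr a * W)" if "0 < R" for R B W :: real
        using that by (simp add: powr_mult powr_diff powr_minus)
      from scale[OF r(1), of avg_const "ball_growth x ?r'"] show ?thesis
        by (simp add: mult_ac)
    qed
    also have "\<dots> \<le> avg_const * 2 powr N * 1 * (w * \<theta> ^ k)"
    proof -
      have "?r' powr a * ball_growth x ?r' \<le> w * (2 ^ Suc k) powr (A - N / P)"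
        using ball_growth_decay[OF d one_le_power[of 2 "Suc k"], of x] by (simp add: w_def a_def)
      also have "(2 ^ Suc k) powr (A - N / P) = \<theta> ^ Suc k"
        using powr_mult_two_power[of 1 "Suc k" "A - N / P"] by (simp add: \<theta>_def)
      also have "w * \<theta> ^ Suc k \<le> w * \<theta> ^ k"
        using w \<theta> by (intro mult_left_mono power_decreasing) auto
      finally have 1: "?r' powr a * ball_growth x ?r' \<le> w * \<theta> ^ k" .
      have 2: "2 powr (- a) \<le> 1" using a powr_mono[of "-a" 0 2] by simp
      have "avg_const * 2 powr N * 2 powr (- a) \<le> avg_const * 2 powr N * 1"
        using 2 avg_const_pos by (intro mult_left_mono) auto
      then show ?thesis using avg_const_pos by (intro mult_mono[OF _ 1]) (auto simp: ball_growth_def)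
    qed
    finally show "(\<integral>\<^sup>+y. ?G k y \<partial>lborel) \<le> ennreal (avg_const * 2 powr N * w * \<theta> ^ k)"
      by (simp add: ennreal_leI mult.assoc)
  qed (use \<theta> w avg_const_pos in auto)
  then show ?thesis by (simp add: far_const_def w_def \<theta>_def a_def)
qed

section \<open>The weak-type estimate at a fixed level\<close>

abbreviation kern :: "real ^ 'n \<Rightarrow> real ^ 'n \<Rightarrow> real" where
  "kern x y \<equiv> norm (x - y) powr (\<alpha> x - N)"

definition potential :: "real ^ 'n \<Rightarrow> ennreal" where
  "potential x = (\<integral>\<^sup>+y. ennreal (f y * kern x y) \<partial>lborel)"

lemma e_meas[measurable]: "(\<lambda>x. e x) \<in> borel_measurable borel"
  and q_meas[measurable]: "(\<lambda>x. q x) \<in> borel_measurable borel"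
  unfolding conj_ratio_def conj_exp_def by measurable

lemma potential_meas[measurable]: "potential \<in> borel_measurable borel"
proof -
  have "(\<lambda>x. \<integral>\<^sup>+y. ennreal (f y * kern x y) \<partial>lborel) \<in> borel_measurable lborel"
    by measurable
  then show ?thesis by (simp add: potential_def[abs_def])
qed

lemma e_ge_1: "1 \<le> e x" "1 \<le> einf"
  using p_bounds[of x] \<alpha>_bounds[of x] pinf ainf AP
  by (auto intro!: conj_ratio_bounds(1)[where P = P and A = A])

lemma q_eq: "q x = p x * e x" "qinf = pinf * einf"
  by (simp_all add: conj_exp_eq)

lemma q_ge: "1 \<le> q x" "pm - 1 \<le> q x - e x" "1 \<le> qinf"
proof -
  show "1 \<le> q x" "1 \<le> qinf"
    using mult_mono[of 1 "p x" 1 "e x"] mult_mono[of 1 "pinf" 1 "einf"] e_ge_1(1)[of x] e_ge_1(2)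
    by (auto simp: q_eq)
  have "(pm - 1) * 1 \<le> (p x - 1) * e x"
    using pm p_bounds[of x] e_ge_1 by (intro mult_mono) auto
  then show "pm - 1 \<le> q x - e x" by (simp add: q_eq algebra_simps)
qed

lemma integral_near_le:
  fixes x :: "real ^ 'n"
  assumes d: "0 < d" and c: "0 \<le> c"
    and le: "\<And>y. norm (x - y) \<le> d \<Longrightarrow> y \<in> S \<Longrightarrow> f y \<le> c"
  shows "(\<integral>\<^sup>+y\<in>{y \<in> S. norm (x - y) \<le> d}. ennreal (f y * kern x y) \<partial>lborel)
    \<le> ennreal (c * (near_const N am * d powr \<alpha> x))"
proof -
  have "(\<integral>\<^sup>+y\<in>{y \<in> S. norm (x - y) \<le> d}. ennreal (f y * kern x y) \<partial>lborel)
    \<le> (\<integral>\<^sup>+y. ennreal c * (ennreal (kern x y) * indicator (cball x d) y) \<partial>lborel)"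
    using le c by (intro nn_integral_mono)
      (auto simp: indicator_def dist_norm mult_right_mono simp flip: ennreal_mult intro!: ennreal_leI)
  also have "\<dots> = ennreal c * (\<integral>\<^sup>+y\<in>cball x d. ennreal (kern x y) \<partial>lborel)"
    by (intro nn_integral_cmult borel_measurable_times_ennreal borel_measurable_indicator) auto
  also have "\<dots> \<le> ennreal c * ennreal (near_const N am * d powr \<alpha> x)"
    unfolding N_def using prod_bounds(3)[of x] am d \<alpha>_bounds
    by (intro mult_left_mono riesz_kernel_near) (auto simp: N_def)
  also have "\<dots> = ennreal (c * (near_const N am * d powr \<alpha> x))"
    using c near_const_pos[OF am, of N] by (simp add: ennreal_mult)
  finally show ?thesis .
qed

text \<open>The cut at radius \<open>d\<close> and height \<open>l\<close>. If the potential exceeds \<open>(K1 + K2 + 1) * t\<close> at a point of \<open>S\<close>,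
  its part \<open>hi\<close> with \<open>|x - y| \<le> d x\<close> and \<open>f y > l y\<close> exceeds \<open>t\<close>. By Chebyshev's inequality and Tonelli's
  theorem it remains to integrate the kernel in its first variable, with the weight \<open>t powr q x\<close>; \<open>J\<close> is a
  bound for this dual integral.\<close>
lemma weak_type_by_truncation:
  fixes d l J :: "real ^ 'n \<Rightarrow> real"
  assumes [measurable]: "d \<in> borel_measurable borel" "l \<in> borel_measurable borel"
      "S \<in> sets borel"
    and t: "0 < t" and K: "0 \<le> K1" "0 \<le> K2" "0 \<le> K3" and J: "\<And>y. 0 \<le> J y"
    and lo: "\<And>x. x \<in> S \<Longrightarrow> (\<integral>\<^sup>+y\<in>{y \<in> {y. f y \<le> l y}. norm (x - y) \<le> d x}.
      ennreal (f y * kern x y) \<partial>lborel) \<le> ennreal (K1 * t)"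
    and far: "\<And>x. x \<in> S \<Longrightarrow> (\<integral>\<^sup>+y\<in>{y. d x < norm (x - y)}.
      ennreal (f y * kern x y) \<partial>lborel) \<le> ennreal (K2 * t)"
    and inner: "\<And>y. (\<integral>\<^sup>+x\<in>{x \<in> S. norm (x - y) \<le> d x}.
      ennreal (kern x y * t powr q x) \<partial>lborel) \<le> ennreal (J y)"
    and outer: "(\<integral>\<^sup>+y\<in>{y. l y < f y}. ennreal (f y * J y) \<partial>lborel) \<le> ennreal (K3 * t)"
  shows "(\<integral>\<^sup>+x\<in>{x \<in> S. ennreal ((K1 + K2 + 1) * t) < potential x}. ennreal (t powr q x) \<partial>lborel)
    \<le> ennreal K3"
proof -
  define h where "h = (\<lambda>x y. ennreal (f y * kern x y) *
    indicator {w. l (snd w) < f (snd w) \<and> norm (fst w - snd w) \<le> d (fst w)} (x, y))"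
  have h_meas: "case_prod h \<in> borel_measurable (lborel \<Otimes>\<^sub>M lborel)"
    unfolding h_def by measurable
  define hi where "hi = (\<lambda>x. \<integral>\<^sup>+y. h x y \<partial>lborel)"
  have h1[measurable]: "h x \<in> borel_measurable lborel" for x
    using measurable_compose[OF measurable_Pair1'[of x lborel lborel] h_meas] by simp
  have hi_meas[measurable]: "hi \<in> borel_measurable lborel"
    unfolding hi_def using lborel.borel_measurable_nn_integral[OF h_meas] by simp
  have hi_big: "ennreal t < hi x" if x: "x \<in> S" "ennreal ((K1 + K2 + 1) * t) < potential x" for x
  proof (rule ccontr)
    assume "\<not> ennreal t < hi x"
    then have hi_le: "hi x \<le> ennreal t" by simp
    let ?lo = "\<lambda>y. ennreal (f y * kern x y) * indicator {y \<in> {y. f y \<le> l y}. norm (x - y) \<le> d x} y"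
    let ?far = "\<lambda>y. ennreal (f y * kern x y) * indicator {y. d x < norm (x - y)} y"
    have "potential x = (\<integral>\<^sup>+y. ?lo y + ?far y + h x y \<partial>lborel)"
      unfolding potential_def by (intro nn_integral_cong) (auto simp: indicator_def h_def)
    also have "\<dots> = (\<integral>\<^sup>+y. ?lo y \<partial>lborel) + (\<integral>\<^sup>+y. ?far y \<partial>lborel) + hi x"
    proof -
      have m: "?lo \<in> borel_measurable lborel" "?far \<in> borel_measurable lborel"
        by measurable
      then show ?thesis unfolding hi_def by (simp add: nn_integral_add)
    qed
    also have "\<dots> \<le> ennreal (K1 * t) + ennreal (K2 * t) + ennreal t"
      using hi_le lo[OF x(1)] far[OF x(1)] by (intro add_mono) auto
    also have "\<dots> = ennreal ((K1 + K2 + 1) * t)"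
      using K t by (simp add: ennreal_plus[symmetric] algebra_simps del: ennreal_plus)
    finally show False using x(2) by simp
  qed
  have "(\<integral>\<^sup>+x\<in>{x \<in> S. ennreal ((K1 + K2 + 1) * t) < potential x}. ennreal (t powr q x) \<partial>lborel)
    \<le> (\<integral>\<^sup>+x. ennreal (1 / t) * (hi x * (ennreal (t powr q x) * indicator S x)) \<partial>lborel)"
  proof (rule nn_integral_mono)
    fix x
    show "ennreal (t powr q x) * indicator {x \<in> S. ennreal ((K1 + K2 + 1) * t) < potential x} x
      \<le> ennreal (1 / t) * (hi x * (ennreal (t powr q x) * indicator S x))"
    proof (cases "x \<in> S \<and> ennreal ((K1 + K2 + 1) * t) < potential x")
      case True
      have "ennreal 1 = ennreal (1 / t) * ennreal t" using t by (simp flip: ennreal_mult)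
      also have "\<dots> \<le> ennreal (1 / t) * hi x"
        using hi_big[of x] True by (intro mult_left_mono) auto
      finally have "1 * ennreal (t powr q x) \<le> ennreal (1 / t) * hi x * ennreal (t powr q x)"
        by (intro mult_right_mono) auto
      then show ?thesis using True by (simp add: mult.assoc)
    qed auto
  qed
  also have "\<dots> = ennreal (1 / t) * (\<integral>\<^sup>+x. hi x * (ennreal (t powr q x) * indicator S x) \<partial>lborel)"
    by (intro nn_integral_cmult) measurable
  also have "(\<integral>\<^sup>+x. hi x * (ennreal (t powr q x) * indicator S x) \<partial>lborel)
    = (\<integral>\<^sup>+x. \<integral>\<^sup>+y. h x y * (ennreal (t powr q x) * indicator S x) \<partial>lborel \<partial>lborel)"
    unfolding hi_def by (intro nn_integral_cong nn_integral_multc[symmetric]) simp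
  also have "\<dots> = (\<integral>\<^sup>+y. \<integral>\<^sup>+x. h x y * (ennreal (t powr q x) * indicator S x) \<partial>lborel \<partial>lborel)"
  proof (rule lborel_pair.Fubini'[symmetric])
    have "(\<lambda>w. case_prod h w * (ennreal (t powr q (fst w)) * indicator S (fst w)))
      \<in> borel_measurable (lborel \<Otimes>\<^sub>M lborel)"
      using h_meas by measurable
    then show "(\<lambda>(x, y). h x y * (ennreal (t powr q x) * indicator S x))
      \<in> borel_measurable (lborel \<Otimes>\<^sub>M lborel)"
      by (simp add: split_beta')
  qed
  also have "\<dots> \<le> (\<integral>\<^sup>+y\<in>{y. l y < f y}. ennreal (f y * J y) \<partial>lborel)"
  proof (rule nn_integral_mono)
    fix y
    have "(\<integral>\<^sup>+x. h x y * (ennreal (t powr q x) * indicator S x) \<partial>lborel)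
      = (\<integral>\<^sup>+x. (ennreal (f y) * indicator {y. l y < f y} y) *
          (ennreal (kern x y * t powr q x) * indicator {x \<in> S. norm (x - y) \<le> d x} x) \<partial>lborel)"
      using f_nonneg[of y]
      by (intro nn_integral_cong) (auto simp: h_def indicator_def ennreal_mult mult_ac)
    also have "\<dots> = (ennreal (f y) * indicator {y. l y < f y} y) *
        (\<integral>\<^sup>+x\<in>{x \<in> S. norm (x - y) \<le> d x}. ennreal (kern x y * t powr q x) \<partial>lborel)"
      by (intro nn_integral_cmult) measurable
    also have "\<dots> \<le> (ennreal (f y) * indicator {y. l y < f y} y) * ennreal (J y)"
      by (intro mult_left_mono inner) auto
    also have "\<dots> = ennreal (f y * J y) * indicator {y. l y < f y} y"
      using f_nonneg[of y] J[of y] by (simp add: ennreal_mult mult_ac)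
    finally show "(\<integral>\<^sup>+x. h x y * (ennreal (t powr q x) * indicator S x) \<partial>lborel)
      \<le> ennreal (f y * J y) * indicator {y. l y < f y} y" .
  qed
  also have "\<dots> \<le> ennreal (K3 * t)" by (rule outer)
  finally have "(\<integral>\<^sup>+x\<in>{x \<in> S. ennreal ((K1 + K2 + 1) * t) < potential x}. ennreal (t powr q x) \<partial>lborel)
    \<le> ennreal (1 / t) * ennreal (K3 * t)"
    by (simp add: mult_left_mono)
  also have "\<dots> = ennreal K3" using t K by (simp flip: ennreal_mult)
  finally show ?thesis .
qed

subsection \<open>Levels above one\<close>

definition upper_ratio :: real where "upper_ratio = N / (N - A * P)"

lemma e_le: "e x \<le> upper_ratio"
  unfolding upper_ratio_def using p_bounds[of x] \<alpha>_bounds[of x] AP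
  by (intro conj_ratio_bounds(2)) auto

lemma radius_le:
  assumes t: "1 \<le> t"
  shows "t powr (- q x / N) \<le> t powr (- 1 / N)"
  using t q_ge(1)[of x] by (intro powr_mono) (auto simp: divide_right_mono)

lemma radius_le_1:
  assumes t: "1 \<le> t"
  shows "t powr (- q x / N) \<le> 1"
  using t q_ge(1)[of x] powr_mono[of "- q x / N" 0 t] by (auto intro: divide_nonpos_pos)

lemma q_e_relation: "q x * \<alpha> x / N = e x - 1" "qinf * ainf / N = einf - 1"
  using conj_exp_relations(1)[of "p x" "\<alpha> x" N] conj_exp_relations(1)[of pinf ainf N] prod_bounds(1)[of x] prod_bounds(2)
  by auto

text \<open>With \<open>g = f powr (1 / e)\<close> the integrand is \<open>(g / t) powr e * t powr q\<close>, on the set \<open>g > t\<close>. On the shell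
  \<open>g \<approx> 2 ^ k * t\<close> it is of order \<open>2 powr (k * (e - q))\<close> times the integrand of the modular inequality at
  level \<open>2 ^ k * t\<close>, and \<open>e - q \<le> 1 - pm < 0\<close>.\<close>
lemma integral_weighted_excess:
  assumes t: "0 < t"
  shows "(\<integral>\<^sup>+y\<in>{y. t powr e y < f y}. ennreal (f y * t powr (q y - e y)) \<partial>lborel)
    \<le> ennreal (2 powr upper_ratio * C / (1 - 2 powr (1 - pm)))"
proof (rule dyadic_nn_integral_bound[where u = "\<lambda>y. f y powr (1 / e y) / t" and
      G = "\<lambda>k y. ennreal (2 powr upper_ratio * (2 powr (1 - pm)) ^ k) *
        (ennreal ((t * 2 ^ k) powr q y) * indicator {y. t * 2 ^ k < f y powr (1 / e y)} y)"])
  show "(\<lambda>y. ennreal (2 powr upper_ratio * (2 powr (1 - pm)) ^ k) *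
    (ennreal ((t * 2 ^ k) powr q y) * indicator {y. t * 2 ^ k < f y powr (1 / e y)} y))
    \<in> borel_measurable lborel" for k
    by measurable
  have e0: "0 < e y" for y using e_ge_1(1)[of y] by linarith
  show "1 < f y powr (1 / e y) / t"
    if "ennreal (f y * t powr (q y - e y)) * indicator {y. t powr e y < f y} y \<noteq> 0" for y
  proof -
    have "t powr e y < f y" using that by (auto simp: indicator_def split: if_splits)
    then have "(t powr e y) powr (1 / e y) < f y powr (1 / e y)"
      using e0[of y] t by (intro powr_less_mono2) auto
    then show ?thesis using t e0[of y] by (simp add: powr_powr)
  qed
next
  have e0: "0 < e y" for y using e_ge_1(1)[of y] by linarith
  fix y and k :: nat
  assume nz: "ennreal (f y * t powr (q y - e y)) * indicator {y. t powr e y < f y} y \<noteq> 0"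
    and k: "2 ^ k < f y powr (1 / e y) / t" "f y powr (1 / e y) / t \<le> 2 ^ Suc k"
  have f0: "0 < f y" using nz f_nonneg[of y] by (cases "f y = 0") auto
  have "f y = (f y powr (1 / e y)) powr e y" using f0 e0[of y] by (simp add: powr_powr)
  also have "\<dots> \<le> (t * 2 ^ k * 2) powr e y"
    using k(2) t e0[of y] by (intro powr_mono2) (auto simp: field_simps)
  also have "\<dots> = (t * 2 ^ k) powr e y * 2 powr e y" using t by (simp add: powr_mult)
  also have "\<dots> \<le> (t * 2 ^ k) powr e y * 2 powr upper_ratio"
    using e_le by (intro mult_left_mono powr_mono) auto
  finally have f_le: "f y \<le> t powr e y * (2 powr e y) ^ k * 2 powr upper_ratio"
    using t by (simp add: powr_mult_two_power)
  have split: "(2 powr e y) ^ k = (2 powr q y) ^ k * (2 powr (e y - q y)) ^ k"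
    by (simp add: powr_diff field_simps)
  have "f y * t powr (q y - e y) \<le> t powr e y * (2 powr e y) ^ k * 2 powr upper_ratio * t powr (q y - e y)"
    using f_le by (rule mult_right_mono) simp
  also have "\<dots> = 2 powr upper_ratio * (2 powr (e y - q y)) ^ k * (t * 2 ^ k) powr q y"
    using t by (simp add: split powr_mult_two_power powr_diff)
  also have "\<dots> \<le> 2 powr upper_ratio * (2 powr (1 - pm)) ^ k * (t * 2 ^ k) powr q y"
    using q_ge(2)[of y] by (intro mult_right_mono mult_left_mono power_mono powr_mono) auto
  finally have main: "f y * t powr (q y - e y)
    \<le> 2 powr upper_ratio * (2 powr (1 - pm)) ^ k * (t * 2 ^ k) powr q y" .
  have "t * 2 ^ k < f y powr (1 / e y)" using k(1) t by (simp add: field_simps)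
  then show "ennreal (f y * t powr (q y - e y)) * indicator {y. t powr e y < f y} y
    \<le> ennreal (2 powr upper_ratio * (2 powr (1 - pm)) ^ k) *
      (ennreal ((t * 2 ^ k) powr q y) * indicator {y. t * 2 ^ k < f y powr (1 / e y)} y)"
    using ennreal_leI[OF main] by (auto simp: indicator_def ennreal_mult)
next
  fix k :: nat
  have "(\<integral>\<^sup>+y. ennreal (2 powr upper_ratio * (2 powr (1 - pm)) ^ k) *
      (ennreal ((t * 2 ^ k) powr q y) * indicator {y. t * 2 ^ k < f y powr (1 / e y)} y) \<partial>lborel)
    = ennreal (2 powr upper_ratio * (2 powr (1 - pm)) ^ k) *
      (\<integral>\<^sup>+y\<in>{y. t * 2 ^ k < f y powr (1 / e y)}. ennreal ((t * 2 ^ k) powr q y) \<partial>lborel)"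
    by (intro nn_integral_cmult) measurable
  also have "\<dots> \<le> ennreal (2 powr upper_ratio * (2 powr (1 - pm)) ^ k) * ennreal C"
    using t by (intro mult_left_mono weak_q) auto
  also have "\<dots> = ennreal (2 powr upper_ratio * C * (2 powr (1 - pm)) ^ k)"
    using C by (simp add: mult_ac flip: ennreal_mult)
  finally show "(\<integral>\<^sup>+y. ennreal (2 powr upper_ratio * (2 powr (1 - pm)) ^ k) *
      (ennreal ((t * 2 ^ k) powr q y) * indicator {y. t * 2 ^ k < f y powr (1 / e y)} y) \<partial>lborel)
    \<le> ennreal (2 powr upper_ratio * C * (2 powr (1 - pm)) ^ k)" .
qed (use C two_powr_less_1 in auto)

text \<open>All exponents are evaluated at the integration variable \<open>x\<close>. Since \<open>|x - y| \<le> t powr (- 1 / N) \<le> 1\<close>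
  on the domain, each of them may be moved to \<open>y\<close> at the cost of a factor \<open>X\<close>; the radius then changes by
  a bounded factor too, and the integral is that of a fixed Riesz kernel over a ball about \<open>y\<close>.\<close>
lemma dual_kernel_high_level:
  fixes y :: "real ^ 'n"
  assumes t: "1 \<le> t"
  shows "(\<integral>\<^sup>+x\<in>{x \<in> UNIV. norm (x - y) \<le> t powr (- q x / N)}.
      ennreal (kern x y * t powr q x) \<partial>lborel)
    \<le> ennreal (X * X * (near_const N am * X powr N) * (t * t powr (q y - e y)))"
proof -
  define d where "d = t powr (- q y / N)"
  have near: "0 < near_const N am" by (rule near_const_pos) (use am in auto)
  have "(\<integral>\<^sup>+x\<in>{x \<in> UNIV. norm (x - y) \<le> t powr (- q x / N)}.
      ennreal (kern x y * t powr q x) \<partial>lborel)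
    \<le> (\<integral>\<^sup>+x. ennreal (X * X * t powr q y) *
        (ennreal (norm (y - x) powr (\<alpha> y - N)) * indicator (cball y (X * d)) x) \<partial>lborel)"
  proof (rule nn_integral_mono)
    fix x
    show "ennreal (kern x y * t powr q x) * indicator {x \<in> UNIV. norm (x - y) \<le> t powr (- q x / N)} x
      \<le> ennreal (X * X * t powr q y) *
        (ennreal (norm (y - x) powr (\<alpha> y - N)) * indicator (cball y (X * d)) x)"
    proof (cases "norm (x - y) \<le> t powr (- q x / N)")
      case True
      have small: "norm (x - y) \<le> t powr (- 1 / N)" "norm (x - y) \<le> 1"
        using True radius_le[OF t, of x] radius_le_1[OF t, of x] by linarith+
      have qx: "t powr q x \<le> X * t powr q y"
        using small(1) t by (intro log_regular_local[OF q_reg]) (auto simp: norm_minus_commute)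
      have qy: "t powr q y \<le> X * t powr q x"
        using small(1) t by (intro log_regular_local[OF q_reg]) auto
      have "norm (x - y) powr \<alpha> x \<le> X * norm (x - y) powr \<alpha> y"
        using small(2) N_ge_1 by (intro log_regular_local_dist[OF \<alpha>_reg]) auto
      then have "norm (x - y) powr \<alpha> x * norm (x - y) powr (- N)
          \<le> X * norm (x - y) powr \<alpha> y * norm (x - y) powr (- N)"
        by (intro mult_right_mono) auto
      then have ker: "kern x y \<le> X * norm (x - y) powr (\<alpha> y - N)"
        by (simp add: powr_add[symmetric] mult.assoc)
      have "t powr (- q x / N) = (t powr q x) powr (- 1 / N)" by (simp add: powr_powr)
      also have "\<dots> \<le> (t powr q y / X) powr (- 1 / N)"
        using qy t by (intro powr_mono2') (auto simp: field_simps)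
      also have "\<dots> = X powr (1 / N) * d"
        using t by (simp add: powr_divide powr_powr d_def powr_minus field_simps)
      also have "\<dots> \<le> X powr 1 * d"
        using X_ge_1 N_ge_1 by (intro mult_right_mono powr_mono) (auto simp: d_def)
      finally have rad: "t powr (- q x / N) \<le> X * d" by simp
      have "kern x y * t powr q x \<le> X * norm (x - y) powr (\<alpha> y - N) * (X * t powr q y)"
        using ker qx by (intro mult_mono) auto
      also have "\<dots> = X * X * t powr q y * norm (y - x) powr (\<alpha> y - N)"
        by (simp add: norm_minus_commute mult_ac)
      finally have "ennreal (kern x y * t powr q x)
          \<le> ennreal (X * X * t powr q y) * ennreal (norm (y - x) powr (\<alpha> y - N))"
        by (subst ennreal_mult[symmetric]) (auto intro: ennreal_leI)
      moreover have "x \<in> cball y (X * d)"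
        using True rad by (auto simp: dist_norm norm_minus_commute)
      ultimately show ?thesis using True by simp
    qed simp
  qed
  also have "\<dots> = ennreal (X * X * t powr q y) *
      (\<integral>\<^sup>+x\<in>cball y (X * d). ennreal (norm (y - x) powr (\<alpha> y - N)) \<partial>lborel)"
    by (intro nn_integral_cmult borel_measurable_times_ennreal borel_measurable_indicator) auto
  also have "\<dots> \<le> ennreal (X * X * t powr q y) * ennreal (near_const N am * (X * d) powr \<alpha> y)"
    unfolding N_def using prod_bounds(3)[of y] am \<alpha>_bounds t
    by (intro mult_left_mono riesz_kernel_near) (auto simp: N_def d_def)
  also have "\<dots> = ennreal (X * X * t powr q y * (near_const N am * (X * d) powr \<alpha> y))"
    using near by (intro ennreal_mult[symmetric]) auto
  also have "\<dots> \<le> ennreal (X * X * t powr q y * (near_const N am * (X powr N * d powr \<alpha> y)))"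
  proof (intro ennreal_leI mult_left_mono)
    have "(X * d) powr \<alpha> y = X powr \<alpha> y * d powr \<alpha> y" by (simp add: powr_mult d_def)
    also have "\<dots> \<le> X powr N * d powr \<alpha> y"
      using X_ge_1 prod_bounds(3)[of y] by (intro mult_right_mono powr_mono) auto
    finally show "(X * d) powr \<alpha> y \<le> X powr N * d powr \<alpha> y" .
  qed (use near in auto)
  also have "d powr \<alpha> y = t powr (1 - e y)"
    using q_e_relation(1)[of y] t by (simp add: d_def powr_powr)
  also have "X * X * t powr q y * (near_const N am * (X powr N * t powr (1 - e y)))
    = X * X * (near_const N am * X powr N) * (t * t powr (q y - e y))"
    using t by (simp add: powr_diff)
  finally show ?thesis .
qed

lemma weak_type_high_levels:
  obtains K1 K2 where "1 \<le> K1" "0 \<le> K2"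
    "\<And>t. 1 \<le> t \<Longrightarrow> (\<integral>\<^sup>+x\<in>{x. ennreal (K1 * t) < potential x}. ennreal (t powr q x) \<partial>lborel)
      \<le> ennreal K2"
proof -
  have near: "0 < near_const N am" by (rule near_const_pos) (use am in auto)
  define Q where "Q = X * X * (near_const N am * X powr N)"
  define R where "R = 2 powr upper_ratio * C / (1 - 2 powr (1 - pm))"
  have Q: "0 \<le> Q" using near by (simp add: Q_def)
  have R: "0 \<le> R" using C two_powr_less_1 by (simp add: R_def)
  have lev: "(\<integral>\<^sup>+x\<in>{x \<in> UNIV. ennreal ((X * near_const N am + far_const + 1) * t) < potential x}.
      ennreal (t powr q x) \<partial>lborel) \<le> ennreal (Q * R)" if t: "1 \<le> t" for t
  proof (rule weak_type_by_truncation[where d = "\<lambda>x. t powr (- q x / N)" and l = "\<lambda>y. t powr e y"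
        and J = "\<lambda>y. Q * (t * t powr (q y - e y))"])
    have d0: "0 < t powr (- q x / N)" for x using t by simp
    show "(\<integral>\<^sup>+y\<in>{y \<in> {y. f y \<le> t powr e y}. norm (x - y) \<le> t powr (- q x / N)}.
      ennreal (f y * kern x y) \<partial>lborel) \<le> ennreal (X * near_const N am * t)" for x
    proof -
      have "(\<integral>\<^sup>+y\<in>{y \<in> {y. f y \<le> t powr e y}. norm (x - y) \<le> t powr (- q x / N)}.
        ennreal (f y * kern x y) \<partial>lborel)
        \<le> ennreal (X * t powr e x * (near_const N am * (t powr (- q x / N)) powr \<alpha> x))"
      proof (rule integral_near_le[OF d0])
        fix y assume y: "norm (x - y) \<le> t powr (- q x / N)" "y \<in> {y. f y \<le> t powr e y}"
        have "t powr e y \<le> X * t powr e x"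
          using t y(1) radius_le[OF t, of x] by (intro log_regular_local[OF e_reg]) auto
        then show "f y \<le> X * t powr e x" using y(2) by simp
      qed simp
      also have "(t powr (- q x / N)) powr \<alpha> x = t powr (1 - e x)"
        using q_e_relation(1)[of x] t by (simp add: powr_powr)
      also have "X * t powr e x * (near_const N am * t powr (1 - e x)) = X * near_const N am * t"
        using t by (simp add: powr_diff)
      finally show ?thesis .
    qed
    show "(\<integral>\<^sup>+y\<in>{y. t powr (- q x / N) < norm (x - y)}.
      ennreal (f y * kern x y) \<partial>lborel) \<le> ennreal (far_const * t)" for x
    proof -
      have "(t powr (- q x / N)) powr \<alpha> x * ball_growth x (t powr (- q x / N))
        = (t powr (- q x / N)) powr (\<alpha> x - N / p x)"
        unfolding ball_growth_def if_P[OF radius_le_1[OF t, of x]] powr_add[symmetric] by simp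
      also have "\<dots> = t powr (- q x / N * (\<alpha> x - N / p x))" by (rule powr_powr)
      also have "- q x / N * (\<alpha> x - N / p x) = 1"
        using conj_exp_relations(2)[of "p x" "\<alpha> x" N] prod_bounds(1)[of x] by simp
      finally show ?thesis using integral_far_le_growth[OF d0, of x x] t by simp
    qed
    show "(\<integral>\<^sup>+x\<in>{x \<in> UNIV. norm (x - y) \<le> t powr (- q x / N)}.
      ennreal (kern x y * t powr q x) \<partial>lborel) \<le> ennreal (Q * (t * t powr (q y - e y)))" for y
      unfolding Q_def by (rule dual_kernel_high_level[OF t])
    have "(\<integral>\<^sup>+y\<in>{y. t powr e y < f y}. ennreal (f y * (Q * (t * t powr (q y - e y)))) \<partial>lborel)
      = (\<integral>\<^sup>+y. ennreal (Q * t) *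
          (ennreal (f y * t powr (q y - e y)) * indicator {y. t powr e y < f y} y) \<partial>lborel)"
      using Q t f_nonneg
      by (intro nn_integral_cong) (auto simp: indicator_def mult_ac simp flip: ennreal_mult)
    also have "\<dots> = ennreal (Q * t) *
        (\<integral>\<^sup>+y\<in>{y. t powr e y < f y}. ennreal (f y * t powr (q y - e y)) \<partial>lborel)"
      by (intro nn_integral_cmult) measurable
    also have "\<dots> \<le> ennreal (Q * t) * ennreal R"
      unfolding R_def using t by (intro mult_left_mono integral_weighted_excess) auto
    also have "\<dots> = ennreal (Q * R * t)" using Q R t by (simp add: mult_ac flip: ennreal_mult)
    finally show "(\<integral>\<^sup>+y\<in>{y. t powr e y < f y}. ennreal (f y * (Q * (t * t powr (q y - e y)))) \<partial>lborel)
      \<le> ennreal (Q * R * t)" .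
  qed (use t Q R near far_const_pos in auto)
  show thesis
    using near far_const_pos Q R lev
    by (intro that[of "X * near_const N am + far_const + 1" "Q * R"]) auto
qed

subsection \<open>Levels below one\<close>

definition decay_const :: real where "decay_const = exp (qinf * L)"

lemma decay_const_ge_1: "1 \<le> decay_const"
  using q_ge(3) L_nonneg by (simp add: decay_const_def)

text \<open>Any base \<open>r\<close> between one and the radius \<open>t powr (- qinf / N)\<close> is admissible, because \<open>ln r\<close> is then at
  most a multiple of \<open>|ln t|\<close>.\<close>
lemma powr_le_powr_at_infinity:
  assumes t: "0 < t" "t < 1" and x: "t powr (- 1 / N) \<le> norm x"
    and r: "1 \<le> r" "r \<le> t powr (- qinf / N)"
  shows "r powr \<alpha> x \<le> decay_const * r powr ainf"
  unfolding decay_const_def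
proof (rule powr_le_exp_powr)
  have "ln r \<le> ln (t powr (- qinf / N))" using r by (intro ln_mono) auto
  also have "\<dots> = qinf / N * \<bar>ln t\<bar>" using t by (simp add: ln_powr)
  finally have "\<bar>\<alpha> x - ainf\<bar> * \<bar>ln r\<bar> \<le> \<bar>\<alpha> x - ainf\<bar> * (qinf / N * \<bar>ln t\<bar>)"
    using r by (intro mult_left_mono) auto
  also have "\<dots> = qinf / N * (\<bar>\<alpha> x - ainf\<bar> * \<bar>ln t\<bar>)" by simp
  also have "\<dots> \<le> qinf / N * (L * N)"
    using t x q_ge(3) by (intro mult_left_mono log_regular_decay[OF \<alpha>_reg]) auto
  finally show "\<bar>\<alpha> x - ainf\<bar> * \<bar>ln r\<bar> \<le> qinf * L" by (simp add: mult.commute)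
qed (use r in simp)

text \<open>Only for \<open>|x - y| \<ge> 1\<close> can the kernel exponent be replaced by its value at infinity. The unit ball
  about \<open>y\<close>, where \<open>\<alpha> x \<ge> am\<close> is used instead, contributes a constant, and this is absorbed as the radius
  is at least one.\<close>
lemma dual_kernel_low_level:
  fixes y :: "real ^ 'n"
  assumes t: "0 < t" "t < 1"
  shows "(\<integral>\<^sup>+x\<in>{x \<in> {x. t powr (- 1 / N) < norm x}. norm (x - y) \<le> t powr (- qinf / N)}.
      ennreal (kern x y * t powr q x) \<partial>lborel)
    \<le> ennreal (X * (near_const N am * (2 * decay_const)) * (t * t powr (qinf - einf)))"
proof -
  define d where "d = t powr (- qinf / N)"
  have d: "1 \<le> d" using t q_ge(3) powr_mono'[of "- qinf / N" 0 t] by (simp add: d_def divide_nonpos_pos)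
  have Y: "1 \<le> decay_const" by (rule decay_const_ge_1)
  have near: "0 < near_const N am" by (rule near_const_pos) (use am in auto)
  let ?I = "\<lambda>a r x. ennreal (norm (y - x) powr (a - N)) * indicator (cball y r) x"
  have "(\<integral>\<^sup>+x\<in>{x \<in> {x. t powr (- 1 / N) < norm x}. norm (x - y) \<le> d}.
      ennreal (kern x y * t powr q x) \<partial>lborel)
    \<le> (\<integral>\<^sup>+x. ennreal (X * t powr qinf) * (?I am 1 x + ennreal decay_const * ?I ainf d x) \<partial>lborel)"
  proof (rule nn_integral_mono)
    fix x
    show "ennreal (kern x y * t powr q x) *
        indicator {x \<in> {x. t powr (- 1 / N) < norm x}. norm (x - y) \<le> d} x
      \<le> ennreal (X * t powr qinf) * (?I am 1 x + ennreal decay_const * ?I ainf d x)"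
    proof (cases "t powr (- 1 / N) < norm x \<and> norm (x - y) \<le> d")
      case True
      have qx: "t powr q x \<le> X * t powr qinf"
        using t True by (intro log_regular_decay_powr(1)[OF q_reg]) auto
      have ker: "ennreal (kern x y) \<le> ?I am 1 x + ennreal decay_const * ?I ainf d x"
      proof (cases "norm (x - y) \<le> 1")
        case small: True
        have "kern x y \<le> norm (x - y) powr (am - N)"
          using small \<alpha>_bounds(1)[of x] by (intro powr_mono') auto
        then have "ennreal (kern x y) \<le> ?I am 1 x"
          using small by (auto simp: dist_norm norm_minus_commute intro: ennreal_leI)
        then show ?thesis by (rule order_trans) simp
      next
        case False
        have "norm (x - y) powr \<alpha> x \<le> decay_const * norm (x - y) powr ainf"
          using t True False by (intro powr_le_powr_at_infinity) (auto simp: d_def)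
        then have "norm (x - y) powr \<alpha> x * norm (x - y) powr (- N)
            \<le> decay_const * norm (x - y) powr ainf * norm (x - y) powr (- N)"
          by (intro mult_right_mono) auto
        then have "kern x y \<le> decay_const * norm (y - x) powr (ainf - N)"
          by (simp add: powr_add[symmetric] mult.assoc norm_minus_commute)
        then have "ennreal (kern x y) \<le> ennreal decay_const * ?I ainf d x"
          using True Y by (auto simp: dist_norm norm_minus_commute simp flip: ennreal_mult
              intro!: ennreal_leI)
        then show ?thesis by (rule order_trans) simp
      qed
      have "ennreal (kern x y * t powr q x) = ennreal (t powr q x) * ennreal (kern x y)"
        by (simp add: mult.commute flip: ennreal_mult)
      also have "\<dots> \<le> ennreal (X * t powr qinf) * (?I am 1 x + ennreal decay_const * ?I ainf d x)"
        using qx ker by (intro mult_mono ennreal_leI) auto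
      finally show ?thesis using True by simp
    qed auto
  qed
  also have "\<dots> = ennreal (X * t powr qinf) *
      ((\<integral>\<^sup>+x. ?I am 1 x \<partial>lborel) + ennreal decay_const * (\<integral>\<^sup>+x. ?I ainf d x \<partial>lborel))"
  proof -
    have m[measurable]: "?I a r \<in> borel_measurable lborel" for a r
      by (intro borel_measurable_times_ennreal borel_measurable_indicator) auto
    show ?thesis
      by (subst nn_integral_cmult, measurable, subst nn_integral_add, measurable,
          subst nn_integral_cmult, measurable)
  qed
  also have "\<dots> \<le> ennreal (X * t powr qinf) *
      (ennreal (near_const N am * 1 powr am) + ennreal decay_const * ennreal (near_const N am * d powr ainf))"
    unfolding N_def using prod_bounds(4) am d ainf \<alpha>_bounds[of undefined]
    by (intro mult_left_mono add_mono riesz_kernel_near) (auto simp: N_def)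
  also have "\<dots> = ennreal (X * t powr qinf * (near_const N am + decay_const * (near_const N am * d powr ainf)))"
    using near Y by (simp add: ennreal_mult ennreal_plus)
  also have "\<dots> \<le> ennreal (X * t powr qinf * (near_const N am * (2 * decay_const) * d powr ainf))"
  proof (intro ennreal_leI mult_left_mono)
    have "1 \<le> d powr ainf" using d ge_one_powr_ge_zero by auto
    then have "1 * 1 \<le> decay_const * d powr ainf" using Y by (intro mult_mono) auto
    then have "near_const N am * 1 \<le> near_const N am * (decay_const * d powr ainf)"
      using near by (intro mult_left_mono) auto
    then show "near_const N am + decay_const * (near_const N am * d powr ainf)
      \<le> near_const N am * (2 * decay_const) * d powr ainf" by (simp add: algebra_simps)
  qed auto
  also have "d powr ainf = t powr (1 - einf)"
    using q_e_relation(2) t by (simp add: d_def powr_powr)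
  also have "X * t powr qinf * (near_const N am * (2 * decay_const) * t powr (1 - einf))
    = X * (near_const N am * (2 * decay_const)) * (t * t powr (qinf - einf))"
    using t by (simp add: powr_diff)
  finally show ?thesis by (simp add: d_def)
qed

lemma weak_type_low_levels:
  obtains K1 K2 where "1 \<le> K1" "0 \<le> K2"
    "\<And>t. 0 < t \<Longrightarrow> t < 1 \<Longrightarrow>
      (\<integral>\<^sup>+x\<in>{x. ennreal (K1 * t) < potential x}. ennreal (t powr q x) \<partial>lborel) \<le> ennreal K2"
proof -
  have near: "0 < near_const N am" by (rule near_const_pos) (use am in auto)
  have Y: "1 \<le> decay_const" by (rule decay_const_ge_1)
  define Q where "Q = X * (near_const N am * (2 * decay_const))"
  define R where "R = 2 * (V + C * X) / (1 - 2 powr (1 - pm))"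
  define K1 where "K1 = decay_const * near_const N am + decay_const * far_const + 1"
  have Q: "0 \<le> Q" using near Y by (simp add: Q_def)
  have R: "0 \<le> R" using C two_powr_less_1 V_pos by (simp add: R_def)
  have outer_part: "(\<integral>\<^sup>+x\<in>{x \<in> {x. t powr (- 1 / N) < norm x}. ennreal (K1 * t) < potential x}.
      ennreal (t powr q x) \<partial>lborel) \<le> ennreal (Q * R)" if t: "0 < t" "t < 1" for t
    unfolding K1_def
  proof (rule weak_type_by_truncation[where d = "\<lambda>x. t powr (- qinf / N)" and l = "\<lambda>y. t powr einf"
        and J = "\<lambda>y. Q * (t * t powr (qinf - einf))"])
    define d where "d = t powr (- qinf / N)"
    have d: "1 < d"
      using t q_ge(3) powr_less_mono'[of t "- qinf / N" 0] by (simp add: d_def divide_neg_pos)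
    have dx: "d powr \<alpha> x \<le> decay_const * d powr ainf" if "x \<in> {x. t powr (- 1 / N) < norm x}" for x
      using t that d by (intro powr_le_powr_at_infinity) (auto simp: d_def)
    have da: "d powr ainf = t powr (1 - einf)"
      using q_e_relation(2) t by (simp add: d_def powr_powr)
    show "(\<integral>\<^sup>+y\<in>{y \<in> {y. f y \<le> t powr einf}. norm (x - y) \<le> t powr (- qinf / N)}.
      ennreal (f y * kern x y) \<partial>lborel) \<le> ennreal (decay_const * near_const N am * t)"
      if x: "x \<in> {x. t powr (- 1 / N) < norm x}" for x
    proof -
      have "(\<integral>\<^sup>+y\<in>{y \<in> {y. f y \<le> t powr einf}. norm (x - y) \<le> d}.
        ennreal (f y * kern x y) \<partial>lborel)
        \<le> ennreal (t powr einf * (near_const N am * d powr \<alpha> x))"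
        using d by (intro integral_near_le) auto
      also have "\<dots> \<le> ennreal (t powr einf * (near_const N am * (decay_const * t powr (1 - einf))))"
        using dx[OF x] near by (intro ennreal_leI mult_left_mono) (auto simp: da)
      also have "t powr einf * (near_const N am * (decay_const * t powr (1 - einf)))
        = decay_const * near_const N am * t"
        using t by (simp add: powr_diff)
      finally show ?thesis by (simp add: d_def)
    qed
    show "(\<integral>\<^sup>+y\<in>{y. t powr (- qinf / N) < norm (x - y)}.
      ennreal (f y * kern x y) \<partial>lborel) \<le> ennreal (decay_const * far_const * t)"
      if x: "x \<in> {x. t powr (- 1 / N) < norm x}" for x
    proof -
      have "(\<integral>\<^sup>+y\<in>{y. d < norm (x - y)}. ennreal (f y * kern x y) \<partial>lborel)
        \<le> ennreal (far_const * (d powr \<alpha> x * ball_growth x d))"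
        using d by (intro integral_far_le_growth) auto
      also have "\<dots> \<le> ennreal (far_const * (decay_const * d powr ainf * ball_growth x d))"
        using dx[OF x] far_const_pos
        by (intro ennreal_leI mult_left_mono mult_right_mono) (auto simp: ball_growth_def)
      also have "decay_const * d powr ainf * ball_growth x d
        = decay_const * d powr (ainf - N / pinf)"
        using d by (simp add: ball_growth_def flip: powr_add)
      also have "d powr (ainf - N / pinf) = t powr (- qinf / N * (ainf - N / pinf))"
        unfolding d_def by (rule powr_powr)
      also have "- qinf / N * (ainf - N / pinf) = 1"
        using conj_exp_relations(2)[of pinf ainf N] prod_bounds(2) by simp
      finally show ?thesis using t by (simp add: d_def mult_ac)
    qed
    show "(\<integral>\<^sup>+x\<in>{x \<in> {x. t powr (- 1 / N) < norm x}. norm (x - y) \<le> t powr (- qinf / N)}.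
      ennreal (kern x y * t powr q x) \<partial>lborel) \<le> ennreal (Q * (t * t powr (qinf - einf)))" for y
      unfolding Q_def by (rule dual_kernel_low_level[OF t])
    define s where "s = t powr einf"
    have s: "0 < s" "s \<le> 1"
      using t e_ge_1(2) powr_mono'[of 0 einf t] by (auto simp: s_def)
    have J: "0 \<le> Q * (t * t powr (qinf - einf))" using Q t by simp
    have "(\<integral>\<^sup>+y\<in>{y. s < f y}. ennreal (f y * (Q * (t * t powr (qinf - einf)))) \<partial>lborel)
      = (\<integral>\<^sup>+y. ennreal (Q * (t * t powr (qinf - einf))) *
          (ennreal (f y) * indicator {y. s < f y} y) \<partial>lborel)"
      using J f_nonneg
      by (intro nn_integral_cong) (auto simp: indicator_def mult_ac simp flip: ennreal_mult)
    also have "\<dots> = ennreal (Q * (t * t powr (qinf - einf))) *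
        (\<integral>\<^sup>+y\<in>{y. s < f y}. ennreal (f y) \<partial>lborel)"
      by (intro nn_integral_cmult) measurable
    also have "\<dots> \<le> ennreal (Q * (t * t powr (qinf - einf))) * ennreal (R * s powr (1 - pinf))"
      unfolding R_def using s by (intro mult_left_mono integral_above_level_below_one) auto
    also have "\<dots> = ennreal (Q * (t * t powr (qinf - einf)) * (R * s powr (1 - pinf)))"
      using J R by (intro ennreal_mult[symmetric]) auto
    also have "s powr (1 - pinf) = t powr (einf - qinf)"
      by (simp add: s_def powr_powr q_eq algebra_simps)
    also have "Q * (t * t powr (qinf - einf)) * (R * t powr (einf - qinf)) = Q * R * t"
      using t by (simp add: powr_diff)
    finally show "(\<integral>\<^sup>+y\<in>{y. t powr einf < f y}. ennreal (f y * (Q * (t * t powr (qinf - einf)))) \<partial>lborel)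
      \<le> ennreal (Q * R * t)" by (simp add: s_def)
  qed (use t Q R near far_const_pos Y in auto)
  \<comment> \<open>In the excluded ball the weight alone is small enough: \<open>t powr q x \<le> t\<close>.\<close>
  have inner_part: "(\<integral>\<^sup>+x\<in>cball 0 (t powr (- 1 / N)). ennreal (t powr q x) \<partial>lborel) \<le> ennreal V"
    if t: "0 < t" "t < 1" for t
  proof -
    have "(\<integral>\<^sup>+x\<in>cball 0 (t powr (- 1 / N)). ennreal (t powr q x) \<partial>lborel)
      \<le> (\<integral>\<^sup>+x. ennreal (t powr 1) * indicator (cball (0 :: real ^ 'n) (t powr (- 1 / N))) x \<partial>lborel)"
      using t q_ge(1) by (intro nn_integral_mono mult_right_mono ennreal_leI powr_mono') auto
    also have "\<dots> = ennreal t * ennreal (V * (t powr (- 1 / N)) powr N)"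
      using t by (subst nn_integral_cmult_indicator) (auto simp: cball_measure)
    also have "\<dots> = ennreal (t * (V * t powr (- 1)))"
      using t V_pos by (simp add: powr_powr flip: ennreal_mult)
    also have "t * (V * t powr (- 1)) = V" using t by (simp add: powr_minus)
    finally show ?thesis .
  qed
  have "(\<integral>\<^sup>+x\<in>{x. ennreal (K1 * t) < potential x}. ennreal (t powr q x) \<partial>lborel)
    \<le> ennreal (Q * R + V)" if t: "0 < t" "t < 1" for t
  proof -
    let ?a = "\<lambda>x. ennreal (t powr q x) *
      indicator {x \<in> {x. t powr (- 1 / N) < norm x}. ennreal (K1 * t) < potential x} x"
    let ?b = "\<lambda>x. ennreal (t powr q x) * indicator (cball 0 (t powr (- 1 / N))) x"
    have "(\<integral>\<^sup>+x\<in>{x. ennreal (K1 * t) < potential x}. ennreal (t powr q x) \<partial>lborel)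
      \<le> (\<integral>\<^sup>+x. ?a x + ?b x \<partial>lborel)"
      by (intro nn_integral_mono) (auto simp: indicator_def)
    also have "\<dots> = (\<integral>\<^sup>+x. ?a x \<partial>lborel) + (\<integral>\<^sup>+x. ?b x \<partial>lborel)"
    proof (rule nn_integral_add)
      show "?a \<in> borel_measurable lborel" by measurable
      show "?b \<in> borel_measurable lborel"
        by (intro borel_measurable_times_ennreal borel_measurable_indicator) auto
    qed
    also have "\<dots> \<le> ennreal (Q * R) + ennreal V"
      by (intro add_mono outer_part inner_part t)
    finally show ?thesis using Q R V_pos by (simp add: ennreal_plus)
  qed
  moreover have "1 \<le> K1" using near far_const_pos Y by (simp add: K1_def)
  ultimately show thesis
    using Q R V_pos by (intro that[of K1 "Q * R + V"]) auto
qed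

lemma potential_weak_type:
  obtains K where "1 \<le> K"
    "\<And>t. 0 < t \<Longrightarrow> (\<integral>\<^sup>+x\<in>{x. ennreal (K * t) < potential x}. ennreal (t powr q x) \<partial>lborel)
      \<le> ennreal K"
proof -
  obtain K1 K2 where hi: "1 \<le> K1" "0 \<le> K2"
    "\<And>t. 1 \<le> t \<Longrightarrow> (\<integral>\<^sup>+x\<in>{x. ennreal (K1 * t) < potential x}. ennreal (t powr q x) \<partial>lborel)
      \<le> ennreal K2" using weak_type_high_levels by blast
  obtain K3 K4 where lo: "1 \<le> K3" "0 \<le> K4"
    "\<And>t. 0 < t \<Longrightarrow> t < 1 \<Longrightarrow> (\<integral>\<^sup>+x\<in>{x. ennreal (K3 * t) < potential x}.
      ennreal (t powr q x) \<partial>lborel) \<le> ennreal K4" using weak_type_low_levels by blast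
  define K where "K = K1 + K2 + K3 + K4"
  have mono: "(\<integral>\<^sup>+x\<in>{x. ennreal (K * t) < potential x}. ennreal (t powr q x) \<partial>lborel) \<le> ennreal K"
    if "(\<integral>\<^sup>+x\<in>{x. ennreal (B * t) < potential x}. ennreal (t powr q x) \<partial>lborel) \<le> ennreal B'"
      "B \<le> K" "B' \<le> K" "0 < t" for B B' t
  proof -
    have "ennreal (B * t) \<le> ennreal (K * t)" using that by (intro ennreal_leI) auto
    then have "(\<integral>\<^sup>+x\<in>{x. ennreal (K * t) < potential x}. ennreal (t powr q x) \<partial>lborel)
      \<le> (\<integral>\<^sup>+x\<in>{x. ennreal (B * t) < potential x}. ennreal (t powr q x) \<partial>lborel)"
      by (intro nn_integral_mono) (auto simp: indicator_def dest: le_less_trans)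
    also note that(1)
    also have "ennreal B' \<le> ennreal K" using that(3) by (rule ennreal_leI)
    finally show ?thesis .
  qed
  show thesis
  proof (rule that[of K])
    show "1 \<le> K" using hi lo by (simp add: K_def)
    fix t :: real assume t: "0 < t"
    show "(\<integral>\<^sup>+x\<in>{x. ennreal (K * t) < potential x}. ennreal (t powr q x) \<partial>lborel) \<le> ennreal K"
    proof (cases "1 \<le> t")
      case True
      show ?thesis by (rule mono[OF hi(3)[OF True] _ _ t]) (use hi lo in \<open>auto simp: K_def\<close>)
    next
      case False
      then have "t < 1" by simp
      show ?thesis by (rule mono[OF lo(3)[OF t \<open>t < 1\<close>] _ _ t]) (use hi lo in \<open>auto simp: K_def\<close>)
    qed
  qed
qed

end

section \<open>Admissible exponents\<close>

lemma ln_e_plus_ge_1: "0 \<le> s \<Longrightarrow> 1 \<le> ln (exp 1 + s)" for s :: real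
  by (subst ln_ge_iff) (auto intro: add_pos_nonneg)

text \<open>Continuity turns the essential bounds of an exponent into pointwise ones.\<close>
lemma log_Holder_continuous:
  fixes g :: "real ^ 'n \<Rightarrow> real"
  assumes c: "0 < c" and g: "\<And>x y. \<bar>g x - g y\<bar> \<le> c / ln (exp 1 + 1 / norm (x - y))"
  shows "continuous_on UNIV g"
proof (rule continuous_onI)
  fix x :: "real ^ 'n" and \<epsilon> :: real
  assume \<epsilon>: "0 < \<epsilon>"
  have "\<bar>g y - g x\<bar> \<le> \<epsilon>" if y: "dist y x < exp (- c / \<epsilon>)" for y
  proof (cases "y = x")
    case False
    have "exp (c / \<epsilon>) \<le> 1 / norm (y - x)"
      using y False by (simp add: dist_norm exp_minus field_simps)
    then have "exp (c / \<epsilon>) \<le> exp 1 + 1 / norm (y - x)"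
      using exp_ge_zero[of "1 :: real"] by linarith
    then have "c / \<epsilon> \<le> ln (exp 1 + 1 / norm (y - x))"
      by (subst ln_ge_iff) (auto intro: add_pos_nonneg)
    then have "c / ln (exp 1 + 1 / norm (y - x)) \<le> \<epsilon>"
      using \<epsilon> c ln_e_plus_ge_1[of "1 / norm (y - x)"] by (simp add: field_simps)
    with g[of y x] show ?thesis by linarith
  qed (use \<epsilon> in simp)
  then show "\<exists>d>0. \<forall>x'\<in>UNIV. dist x' x < d \<longrightarrow> dist (g x') (g x) \<le> \<epsilon>"
    by (intro exI[of _ "exp (- c / \<epsilon>)"]) (auto simp: dist_real_def)
qed

lemma continuous_AE_le:
  fixes g :: "real ^ 'n \<Rightarrow> real"
  assumes g: "continuous_on UNIV g" and ae: "AE x in lebesgue. g x \<le> u"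
  shows "g x \<le> u"
proof (rule ccontr)
  assume "\<not> g x \<le> u"
  then have ne: "{x. u < g x} \<noteq> {}" using not_le by blast
  have op: "open {x. u < g x}"
    using g by (intro open_Collect_less) auto
  then have "{x. u < g x} \<in> sets lebesgue" by simp
  then have "{x. u < g x} \<in> null_sets lebesgue"
    using ae by (subst AE_iff_null_sets) (auto simp: not_less)
  then show False
    using open_not_negligible[OF op ne] by (simp add: negligible_iff_null_sets)
qed

text \<open>The value at infinity is a limit of values of \<open>g\<close> and therefore obeys the same bounds.\<close>
lemma P0_log_obtain:
  fixes g :: "real ^ 'n \<Rightarrow> real"
  assumes "g \<in> P0_log"
  obtains l u L g0 where "ess_lower g = ereal l" "ess_upper g = ereal u" "0 < l"
    "\<And>x. l \<le> g x" "\<And>x. g x \<le> u" "l \<le> g0" "g0 \<le> u"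
    "log_regular L g g0" "continuous_on UNIV g"
proof -
  obtain c c' g0 where c: "0 < c" "0 < c'"
    and loc: "\<And>x y. \<bar>g x - g y\<bar> \<le> c / ln (exp 1 + 1 / norm (x - y))"
    and dec: "\<And>x. \<bar>g x - g0\<bar> \<le> c' / ln (exp 1 + norm x)"
    using assms unfolding P0_log_def log_Holder_def by blast
  have ess: "0 < ess_lower g" "ess_lower g \<le> ess_upper g" "ess_upper g < \<infinity>"
    using assms by (auto simp: P0_log_def)
  then obtain l u where lu: "ess_lower g = ereal l" "ess_upper g = ereal u" "0 < l"
    by (cases "ess_lower g"; cases "ess_upper g") auto
  have cont: "continuous_on UNIV g" by (rule log_Holder_continuous[OF c(1) loc])
  have upper: "g x \<le> u" for x
  proof (rule continuous_AE_le[OF cont])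
    show "AE x in lebesgue. g x \<le> u"
      using esssup_AE[where M = lebesgue and f = "\<lambda>x. ereal (g x)"] lu(2) by (simp add: ess_upper_def)
  qed
  have "- g x \<le> - l" for x
  proof (rule continuous_AE_le[where g = "\<lambda>x. - g x"])
    have "esssup lebesgue (\<lambda>x. - ereal (g x)) = ereal (- l)"
      using lu(1) by (simp add: ess_lower_def ereal_uminus_eq_reorder)
    then show "AE x in lebesgue. - g x \<le> - l"
      using esssup_AE[where M = lebesgue and f = "\<lambda>x. - ereal (g x)"] by simp
  qed (use cont in \<open>simp add: continuous_on_minus\<close>)
  then have lower: "l \<le> g x" for x by simp
  have near: "\<exists>x. \<bar>g x - g0\<bar> \<le> \<epsilon>" if \<epsilon>: "0 < \<epsilon>" for \<epsilon>
  proof -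
    obtain x :: "real ^ 'n" where x: "norm x = exp (c' / \<epsilon>)"
      by (rule vector_choose_size[of "exp (c' / \<epsilon>)"]) auto
    have "c' / \<epsilon> \<le> ln (exp 1 + norm x)"
      unfolding x by (subst ln_ge_iff) (auto intro: add_pos_nonneg)
    then have "c' / ln (exp 1 + norm x) \<le> \<epsilon>"
      using \<epsilon> c ln_e_plus_ge_1[of "norm x"] by (simp add: field_simps)
    with dec[of x] show ?thesis by (intro exI[of _ x]) linarith
  qed
  have g0: "g0 \<le> u" "l \<le> g0"
  proof -
    show "g0 \<le> u"
    proof (rule field_le_epsilon)
      fix \<epsilon> :: real assume "0 < \<epsilon>"
      from near[OF this] obtain x where "\<bar>g x - g0\<bar> \<le> \<epsilon>" ..
      with upper[of x] show "g0 \<le> u + \<epsilon>" by linarith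
    qed
    show "l \<le> g0"
    proof (rule field_le_epsilon)
      fix \<epsilon> :: real assume "0 < \<epsilon>"
      from near[OF this] obtain x where "\<bar>g x - g0\<bar> \<le> \<epsilon>" ..
      with lower[of x] show "l \<le> g0 + \<epsilon>" by linarith
    qed
  qed
  have "log_regular (max c c') g g0"
    unfolding log_regular_def
  proof (intro conjI allI)
    have mul: "a * w \<le> max c c'" if "a \<le> b / w" "1 \<le> w" "b \<le> max c c'" for a b w :: real
    proof -
      have "a * w \<le> b" using that by (simp add: pos_le_divide_eq)
      with that show ?thesis by linarith
    qed
    show "\<bar>g x - g y\<bar> * ln (exp 1 + 1 / norm (x - y)) \<le> max c c'" for x y
      by (rule mul[OF loc ln_e_plus_ge_1]) auto
    show "\<bar>g x - g0\<bar> * ln (exp 1 + norm x) \<le> max c c'" for x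
      by (rule mul[OF dec ln_e_plus_ge_1]) auto
  qed
  then show thesis
    using that[OF lu lower upper g0(2,1) _ cont] by blast
qed

section \<open>Modular form of the weak norm\<close>

lemma luxemburg_indicator_integrand:
  "ennreal (\<bar>indicator E x / r\<bar> powr s x) = ennreal (\<bar>1 / r\<bar> powr s x) * indicator E x"
  by (auto simp: indicator_def)

text \<open>Enlarging the weak norm \<open>m\<close> to \<open>m + 1\<close> guarantees an admissible \<open>r\<close> below \<open>(m + 1) / t\<close>; the upper bound \<open>b\<close> of the exponent then allows the factor \<open>m + 1\<close> to be pulled out of the modular.\<close>
lemma weak_Lebesgue_modular:
  fixes s :: "real ^ 'n \<Rightarrow> real"
  assumes h: "h \<in> weak_Lebesgue s" and s: "\<And>x. 0 \<le> s x" "\<And>x. s x \<le> b"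
    and s_meas: "s \<in> borel_measurable borel"
  obtains C where "0 \<le> C"
    "\<And>t. 0 < t \<Longrightarrow> (\<integral>\<^sup>+x\<in>{x. ereal t < \<bar>h x\<bar>}. ennreal (t powr s x) \<partial>lebesgue) \<le> ennreal C"
proof -
  define E where "E = (\<lambda>t. {x. ereal t < \<bar>h x\<bar>})"
  define M where "M = (SUP t \<in> {0<..}. ennreal t * luxemburg_norm s (indicator (E t)))"
  have "M < top" using h by (simp add: weak_Lebesgue_def M_def E_def)
  then obtain m where m: "M = ennreal m" "0 \<le> m" by (cases M) auto
  have "(\<integral>\<^sup>+x\<in>E t. ennreal (t powr s x) \<partial>lebesgue) \<le> ennreal ((m + 1) powr b)" if t: "0 < t" for t
  proof -
    have [measurable]: "E t \<in> sets lebesgue"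
    proof -
      have "h \<in> borel_measurable lebesgue" using h by (simp add: weak_Lebesgue_def)
      then have "{x \<in> space lebesgue. ereal t < \<bar>h x\<bar>} \<in> sets lebesgue" by measurable
      then show ?thesis by (simp add: E_def)
    qed
    have [measurable]: "s \<in> borel_measurable lebesgue"
      using s_meas by (intro measurable_completion) simp
    have "ennreal t * luxemburg_norm s (indicator (E t)) \<le> ennreal m"
      unfolding m(1)[symmetric] M_def using t by (intro SUP_upper) auto
    then have "ennreal (1 / t) * (ennreal t * luxemburg_norm s (indicator (E t)))
        \<le> ennreal (1 / t) * ennreal m"
      by (intro mult_left_mono) auto
    then have "luxemburg_norm s (indicator (E t)) \<le> ennreal (m / t)"
      using t m by (simp add: mult.assoc[symmetric] flip: ennreal_mult)
    also have "\<dots> < ennreal ((m + 1) / t)"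
      using t m by (intro ennreal_lessI) (auto simp: divide_strict_right_mono)
    finally obtain r where r: "0 < r" "ennreal r < ennreal ((m + 1) / t)"
      "(\<integral>\<^sup>+x. ennreal (\<bar>indicator (E t) x / r\<bar> powr s x) \<partial>lebesgue) \<le> 1"
      unfolding luxemburg_norm_def Inf_less_iff by blast
    have "r < (m + 1) / t" using r by (simp add: ennreal_less_iff)
    then have tr: "t \<le> (m + 1) * (1 / r)" using r(1) t by (simp add: field_simps)
    have "(\<integral>\<^sup>+x\<in>E t. ennreal (t powr s x) \<partial>lebesgue)
      \<le> (\<integral>\<^sup>+x. ennreal ((m + 1) powr b) * (ennreal (\<bar>1 / r\<bar> powr s x) * indicator (E t) x) \<partial>lebesgue)"
    proof (rule nn_integral_mono)
      fix x
      have "t powr s x \<le> ((m + 1) * (1 / r)) powr s x"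
        using tr t s by (intro powr_mono2) auto
      also have "\<dots> = (m + 1) powr s x * (1 / r) powr s x"
        using m r(1) by (subst powr_mult) auto
      also have "\<dots> \<le> (m + 1) powr b * (1 / r) powr s x"
        using m s by (intro mult_right_mono powr_mono) auto
      finally have "t powr s x \<le> (m + 1) powr b * \<bar>1 / r\<bar> powr s x" using r(1) by simp
      then show "ennreal (t powr s x) * indicator (E t) x
        \<le> ennreal ((m + 1) powr b) * (ennreal (\<bar>1 / r\<bar> powr s x) * indicator (E t) x)"
        by (auto simp: indicator_def simp flip: ennreal_mult intro!: ennreal_leI)
    qed
    also have "\<dots> = ennreal ((m + 1) powr b) *
        (\<integral>\<^sup>+x. ennreal (\<bar>indicator (E t) x / r\<bar> powr s x) \<partial>lebesgue)"
      unfolding luxemburg_indicator_integrand by (intro nn_integral_cmult) measurable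
    also have "\<dots> \<le> ennreal ((m + 1) powr b) * 1" by (intro mult_left_mono r(3)) auto
    finally show ?thesis by simp
  qed
  then show thesis by (intro that[of "(m + 1) powr b"]) (auto simp: E_def)
qed

text \<open>As \<open>s \<ge> 1\<close>, dividing the level by one further factor \<open>K\<close> divides the modular by at least \<open>K\<close> and so
  brings it below one.\<close>
lemma weak_LebesgueI:
  fixes s :: "real ^ 'n \<Rightarrow> real"
  assumes h: "h \<in> borel_measurable lebesgue" and s: "\<And>x. 1 \<le> s x"
    and s_meas: "s \<in> borel_measurable borel" and K: "1 \<le> K"
    and modular: "\<And>t. 0 < t \<Longrightarrow>
      (\<integral>\<^sup>+x\<in>{x. ereal (K * t) < \<bar>h x\<bar>}. ennreal (t powr s x) \<partial>lebesgue) \<le> ennreal K"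
  shows "h \<in> weak_Lebesgue s"
proof -
  have "ennreal t * luxemburg_norm s (indicator {x. ereal t < \<bar>h x\<bar>}) \<le> ennreal (K * K)"
    if t: "0 < t" for t
  proof -
    define E where "E = {x. ereal t < \<bar>h x\<bar>}"
    have [measurable]: "E \<in> sets lebesgue"
    proof -
      have "{x \<in> space lebesgue. ereal t < \<bar>h x\<bar>} \<in> sets lebesgue" using h by measurable
      then show ?thesis by (simp add: E_def)
    qed
    have [measurable]: "s \<in> borel_measurable lebesgue"
      using s_meas by (intro measurable_completion) simp
    define r where "r = K * K / t"
    have r: "0 < r" using K t by (simp add: r_def)
    have "(\<integral>\<^sup>+x. ennreal (\<bar>indicator E x / r\<bar> powr s x) \<partial>lebesgue)
      \<le> (\<integral>\<^sup>+x. ennreal (1 / K) * (ennreal ((t / K) powr s x) * indicator E x) \<partial>lebesgue)"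
    proof (rule nn_integral_mono)
      fix x
      have "\<bar>1 / r\<bar> powr s x = (t / K * (1 / K)) powr s x" using K t by (simp add: r_def)
      also have "\<dots> = (t / K) powr s x * (1 / K) powr s x" using K t by (subst powr_mult) auto
      also have "\<dots> \<le> (t / K) powr s x * (1 / K) powr 1"
        using K s by (intro mult_left_mono powr_mono') auto
      finally have "\<bar>1 / r\<bar> powr s x \<le> 1 / K * (t / K) powr s x" using K by simp
      then show "ennreal (\<bar>indicator E x / r\<bar> powr s x)
        \<le> ennreal (1 / K) * (ennreal ((t / K) powr s x) * indicator E x)"
        unfolding luxemburg_indicator_integrand
        using K by (auto simp: indicator_def simp flip: ennreal_mult intro!: ennreal_leI)
    qed
    also have "\<dots> = ennreal (1 / K) * (\<integral>\<^sup>+x\<in>E. ennreal ((t / K) powr s x) \<partial>lebesgue)"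
      by (intro nn_integral_cmult) measurable
    also have "\<dots> \<le> ennreal (1 / K) * ennreal K"
      using modular[of "t / K"] K t by (intro mult_left_mono) (auto simp: E_def)
    also have "\<dots> = 1" using K by (simp flip: ennreal_mult)
    finally have "luxemburg_norm s (indicator E) \<le> ennreal r"
      unfolding luxemburg_norm_def using r by (intro Inf_lower) auto
    then have "ennreal t * luxemburg_norm s (indicator E) \<le> ennreal t * ennreal r"
      by (intro mult_left_mono) auto
    also have "\<dots> = ennreal (K * K)" using t r by (simp add: r_def flip: ennreal_mult)
    finally show ?thesis by (simp add: E_def)
  qed
  then have "(SUP t \<in> {0<..}. ennreal t * luxemburg_norm s (indicator {x. ereal t < \<bar>h x\<bar>}))
      \<le> ennreal (K * K)"
    by (intro SUP_least) auto
  also have "\<dots> < \<infinity>" by simp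
  finally show ?thesis using h by (simp add: weak_Lebesgue_def)
qed

section \<open>The theorem\<close>

lemma set_nn_integral_lborel_AE_cong:
  assumes "AE x in lborel. x \<in> S \<longleftrightarrow> x \<in> T"
  shows "(\<integral>\<^sup>+x\<in>S. g x \<partial>lebesgue) = (\<integral>\<^sup>+x\<in>T. g x \<partial>lborel)"
  unfolding nn_integral_completion
  by (rule nn_integral_cong_AE) (use assms in eventually_elim, auto simp: indicator_def)

theorem theorem6p6:
  fixes p \<alpha> f :: "real ^ 'n \<Rightarrow> real"
  assumes "p \<in> P1_log"
    and "\<alpha> \<in> P0_log"
    and "1 < ess_lower p"
    and "ess_lower p \<le> ess_upper p"
    and "ess_upper p < ereal (real CARD('n)) / ess_upper \<alpha>"
    and "(\<lambda>x. ereal (f x)) \<in> weak_Lebesgue p"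
    and "(\<lambda>x. ereal (\<bar>f x\<bar> powr (p x / sobolev_conj \<alpha> p x))) \<in> weak_Lebesgue (sobolev_conj \<alpha> p)"
  shows "(\<lambda>x. enn2ereal (riesz_potential \<alpha> f x)) \<in> weak_Lebesgue (sobolev_conj \<alpha> p)"
proof -
  define N where "N = real CARD('n)"
  have N: "1 \<le> N" by (simp add: N_def Suc_leI)
  have "p \<in> P0_log" using assms(1) by (simp add: P1_log_def)
  then obtain pm P Lp pinf where p: "ess_lower p = ereal pm" "ess_upper p = ereal P" "0 < pm"
    "\<And>x. pm \<le> p x" "\<And>x. p x \<le> P" "pm \<le> pinf" "pinf \<le> P"
    "log_regular Lp p pinf" "continuous_on UNIV p" by (rule P0_log_obtain) blast
  from assms(2) obtain am A La ainf where a: "ess_lower \<alpha> = ereal am" "ess_upper \<alpha> = ereal A" "0 < am"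
    "\<And>x. am \<le> \<alpha> x" "\<And>x. \<alpha> x \<le> A" "am \<le> ainf" "ainf \<le> A"
    "log_regular La \<alpha> ainf" "continuous_on UNIV \<alpha>" by (rule P0_log_obtain) blast
  have pm: "1 < pm" using assms(3) p(1) by simp
  have A: "0 < A" using a(3,6,7) by linarith
  have AP: "A * P < N" using assms(5) A by (simp add: p(2) a(2) N_def field_simps)
  have bounds: "0 < p x" "p x \<le> P" "0 < \<alpha> x" "\<alpha> x \<le> A" "0 < pinf" "0 < ainf" "1 \<le> P" for x
    using p(4,5)[of x] a(4,5)[of x] p(6,7) a(6) pm a(3) by linarith+
  have meas [measurable]: "p \<in> borel_measurable borel" "\<alpha> \<in> borel_measurable borel"
    using p(9) a(9) by (auto intro: borel_measurable_continuous_onI)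
  have conj: "sobolev_conj \<alpha> p x = conj_exp N (p x) (\<alpha> x)" for x
    by (simp add: sobolev_conj_def conj_exp_def N_def)
  have ratio: "p x / sobolev_conj \<alpha> p x = 1 / conj_ratio N (p x) (\<alpha> x)" for x
    using bounds(1)[of x] by (simp add: conj conj_exp_eq)
  define E where "E = N / (N - A * P)"
  have E: "conj_ratio N (p x) (\<alpha> x) \<le> E" "1 \<le> conj_ratio N (p x) (\<alpha> x)" for x
    unfolding E_def using bounds AP by (auto intro!: conj_ratio_bounds[where P = P and A = A])
  define K where "K = E + P * (E * E * (A + P))"
  have K: "0 \<le> K" using E[of undefined] A bounds(7) by (auto simp: K_def intro!: add_nonneg_nonneg mult_nonneg_nonneg)
  define L0 where "L0 = max Lp La"
  define L where "L = max L0 (2 * K * L0)"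
  have reg0: "log_regular L0 p pinf" "log_regular L0 \<alpha> ainf"
    using p(8) a(8) by (auto simp: L0_def elim: log_regular_mono)
  have reg: "log_regular L p pinf" "log_regular L \<alpha> ainf"
    "log_regular L (\<lambda>x. conj_exp N (p x) (\<alpha> x)) (conj_exp N pinf ainf)"
    "log_regular L (\<lambda>x. conj_ratio N (p x) (\<alpha> x)) (conj_ratio N pinf ainf)"
  proof -
    show "log_regular L p pinf" "log_regular L \<alpha> ainf"
      using reg0 by (auto simp: L_def elim: log_regular_mono)
    note lip = conj_lipschitz[OF _ _ _ _ _ _ _ _ AP N bounds(7), folded E_def, folded K_def]
    have "log_regular (2 * K * L0) (\<lambda>x. conj_exp N (p x) (\<alpha> x)) (conj_exp N pinf ainf)"
      "log_regular (2 * K * L0) (\<lambda>x. conj_ratio N (p x) (\<alpha> x)) (conj_ratio N pinf ainf)"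
      using bounds p(7) a(7)
      by (auto intro!: log_regular_compose_lipschitz[OF reg0 K] lip)
    then show "log_regular L (\<lambda>x. conj_exp N (p x) (\<alpha> x)) (conj_exp N pinf ainf)"
      "log_regular L (\<lambda>x. conj_ratio N (p x) (\<alpha> x)) (conj_ratio N pinf ainf)"
      by (auto simp: L_def elim: log_regular_mono)
  qed
  have conj_meas [measurable]: "sobolev_conj \<alpha> p \<in> borel_measurable borel"
    unfolding sobolev_conj_def[abs_def] by measurable
  have q: "1 \<le> sobolev_conj \<alpha> p x" "sobolev_conj \<alpha> p x \<le> P * E" for x
  proof -
    have "1 * 1 \<le> p x * conj_ratio N (p x) (\<alpha> x)"
      using E[of x] p(4)[of x] pm by (intro mult_mono) auto
    then show "1 \<le> sobolev_conj \<alpha> p x" by (simp add: conj conj_exp_eq)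
    have "p x * conj_ratio N (p x) (\<alpha> x) \<le> P * E"
      using E[of x] p(5)[of x] bounds by (intro mult_mono) (auto simp: less_imp_le)
    then show "sobolev_conj \<alpha> p x \<le> P * E" by (simp add: conj conj_exp_eq)
  qed
  have "(\<lambda>x. ereal (f x)) \<in> borel_measurable lebesgue"
    using assms(6) by (simp add: weak_Lebesgue_def)
  from borel_measurable_real_of_ereal[OF this] have "f \<in> borel_measurable lebesgue" by simp
  then have "(\<lambda>x. \<bar>f x\<bar>) \<in> borel_measurable lebesgue" by measurable
  then obtain g where g[measurable]: "g \<in> borel_measurable borel"
    and fg: "AE x in lborel. \<bar>f x\<bar> = g x"
    using completion_ex_borel_measurable_real[of "\<lambda>x. \<bar>f x\<bar>" lborel] by auto
  \<comment> \<open>A Borel representative makes the integrand jointly measurable for Tonelli's theorem.\<close>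
  define F where "F = (\<lambda>x. \<bar>g x\<bar>)"
  have F_meas[measurable]: "F \<in> borel_measurable borel" unfolding F_def by measurable
  have fF: "AE x in lborel. \<bar>f x\<bar> = F x" using fg by eventually_elim (simp add: F_def)
  obtain C1 where C1: "0 \<le> C1" "\<And>t. 0 < t \<Longrightarrow>
      (\<integral>\<^sup>+x\<in>{x. ereal t < \<bar>ereal (f x)\<bar>}. ennreal (t powr p x) \<partial>lebesgue) \<le> ennreal C1"
    by (rule weak_Lebesgue_modular[OF assms(6), of P]) (use bounds in \<open>auto simp: less_imp_le\<close>)
  obtain C2 where C2: "0 \<le> C2" "\<And>t. 0 < t \<Longrightarrow>
      (\<integral>\<^sup>+x\<in>{x. ereal t < \<bar>ereal (\<bar>f x\<bar> powr (p x / sobolev_conj \<alpha> p x))\<bar>}.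
        ennreal (t powr sobolev_conj \<alpha> p x) \<partial>lebesgue) \<le> ennreal C2"
    by (rule weak_Lebesgue_modular[OF assms(7), of "P * E"])
      (use q in \<open>auto intro: order_trans[OF zero_le_one]\<close>)
  interpret weak_riesz p \<alpha> F N pm P am A L pinf ainf "max C1 C2"
  proof
    fix t :: real assume t: "0 < t"
    have "(\<integral>\<^sup>+y\<in>{y. t < F y}. ennreal (t powr p y) \<partial>lborel)
      = (\<integral>\<^sup>+x\<in>{x. ereal t < \<bar>ereal (f x)\<bar>}. ennreal (t powr p x) \<partial>lebesgue)"
      by (rule set_nn_integral_lborel_AE_cong[symmetric]) (use fF in eventually_elim, auto)
    also have "\<dots> \<le> ennreal (max C1 C2)"
      by (rule order_trans[OF C1(2)[OF t]]) (auto intro: ennreal_leI)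
    finally show "(\<integral>\<^sup>+y\<in>{y. t < F y}. ennreal (t powr p y) \<partial>lborel) \<le> ennreal (max C1 C2)" .
    have "(\<integral>\<^sup>+y\<in>{y. t < F y powr (1 / conj_ratio N (p y) (\<alpha> y))}.
        ennreal (t powr conj_exp N (p y) (\<alpha> y)) \<partial>lborel)
      = (\<integral>\<^sup>+x\<in>{x. ereal t < \<bar>ereal (\<bar>f x\<bar> powr (p x / sobolev_conj \<alpha> p x))\<bar>}.
        ennreal (t powr sobolev_conj \<alpha> p x) \<partial>lebesgue)"
      unfolding conj[symmetric] ratio[symmetric]
      by (rule set_nn_integral_lborel_AE_cong[symmetric]) (use fF in eventually_elim, auto)
    also have "\<dots> \<le> ennreal (max C1 C2)"
      by (rule order_trans[OF C2(2)[OF t]]) (auto intro: ennreal_leI)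
    finally show "(\<integral>\<^sup>+y\<in>{y. t < F y powr (1 / conj_ratio N (p y) (\<alpha> y))}.
        ennreal (t powr conj_exp N (p y) (\<alpha> y)) \<partial>lborel) \<le> ennreal (max C1 C2)" .
  qed (use N_def pm p a AP reg C1 in \<open>auto simp: F_def\<close>)
  have pot: "riesz_potential \<alpha> f x = potential x" for x
    unfolding riesz_potential_def potential_def nn_integral_completion
  proof (rule nn_integral_cong_AE, use fF in eventually_elim)
    fix y assume "\<bar>f y\<bar> = F y"
    then show "ennreal (\<bar>f y\<bar> / norm (x - y) powr (real CARD('n) - \<alpha> x)) = ennreal (F y * kern x y)"
      using powr_minus_divide[of "norm (x - y)" "N - \<alpha> x"] by (simp add: N_def)
  qed
  obtain B where B: "1 \<le> B" "\<And>t. 0 < t \<Longrightarrow>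
      (\<integral>\<^sup>+x\<in>{x. ennreal (B * t) < potential x}. ennreal (t powr q x) \<partial>lborel) \<le> ennreal B"
    using potential_weak_type by blast
  show ?thesis
  proof (rule weak_LebesgueI[OF _ q(1) conj_meas B(1)])
    have "riesz_potential \<alpha> f \<in> borel_measurable lebesgue"
      using potential_meas by (intro measurable_completion) (simp add: pot[abs_def])
    then show "(\<lambda>x. enn2ereal (riesz_potential \<alpha> f x)) \<in> borel_measurable lebesgue"
      by measurable
    fix t :: real assume t: "0 < t"
    have "(\<integral>\<^sup>+x\<in>{x. ereal (B * t) < \<bar>enn2ereal (riesz_potential \<alpha> f x)\<bar>}.
        ennreal (t powr sobolev_conj \<alpha> p x) \<partial>lebesgue)
      = (\<integral>\<^sup>+x\<in>{x. ennreal (B * t) < potential x}. ennreal (t powr q x) \<partial>lborel)"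
      unfolding conj nn_integral_completion
      using B(1) t by (intro nn_integral_cong)
        (auto simp: indicator_def pot less_ennreal.rep_eq)
    then show "(\<integral>\<^sup>+x\<in>{x. ereal (B * t) < \<bar>enn2ereal (riesz_potential \<alpha> f x)\<bar>}.
        ennreal (t powr sobolev_conj \<alpha> p x) \<partial>lebesgue) \<le> ennreal B"
      using B(2)[OF t] by simp
  qed
qed

end
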